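(* There is a constant $C>0$ such that for every positive integer $k$ and every $k$-permutation $\pi$, $$c(\pi)\le 2^{Ck}\qquad\text{and}\qquad L(\pi)\le 2^{Ck}.$$
   Context: Write $[n]=\{1,\dots,n\}$. An $n$-permutation is a permutation of $[n]$. An $n$-permutation $\sigma$ contains a $k$-permutation $\pi$ if there are integers $1\le x_1<\dots<x_k\le n$ such that for all $1\le i,j\le k$ we have $\sigma(x_i)<\sigma(x_j)$ if and only if $\pi(i)<\pi(j)$; otherwise $\sigma$ avoids $\pi$. $S_n(\pi)$ is the number of $n$-permutations avoiding $\pi$, and $L(\pi)=\lim_{n\to\infty}S_n(\pi)^{1/n}$ (known to exist and be finite). All matrices are binary (entries in $\{0,1\}$). A matrix $A$ contains a $k\times\ell$ matrix $P=(p_{ij})$ if $A$ has a $k\times\ell$ submatrix $D=(d_{ij})$ (choose $k$ rows and $\ell$ columns, keeping their order) with $d_{ij}=1$ whenever $p_{ij}=1$; otherwise $A$ avoids $P$. The mass of a matrix is the number of its one-entries. For a permutation $\pi$ with permutation matrix $P$ (ones exactly at the positions $(i,\pi(i))$), $\mathrm{ex}(n,\pi)$ is the maximum mass of an $n\times n$ matrix that avoids $P$. The Füredi-Hajnal limit is $c(\pi)=\lim_{n\to\infty}\mathrm{ex}(n,\pi)/n$ (known to exist and be finite). *)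

theory Defs
  imports Complex_Main "HOL-Combinatorics.Permutations" "Jordan_Normal_Form.DL_Submatrix"
begin

text \<open>
  A \<open>k\<close>-permutation is a function \<open>\<pi> :: nat \<Rightarrow> nat\<close> with \<open>\<pi> permutes {1..k}\<close>.
  Such a function does not determine \<open>k\<close>, so the length is always passed along.
\<close>

definition perm_contains :: "nat \<Rightarrow> (nat \<Rightarrow> nat) \<Rightarrow> nat \<Rightarrow> (nat \<Rightarrow> nat) \<Rightarrow> bool" where
  "perm_contains n \<sigma> k \<pi> \<longleftrightarrow>
     (\<exists>x :: nat \<Rightarrow> nat. strict_mono_on {1..k} x \<and> x ` {1..k} \<subseteq> {1..n} \<and>
        (\<forall>i\<in>{1..k}. \<forall>j\<in>{1..k}. \<sigma> (x i) < \<sigma> (x j) \<longleftrightarrow> \<pi> i < \<pi> j))"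

definition avoiders_count :: "nat \<Rightarrow> nat \<Rightarrow> (nat \<Rightarrow> nat) \<Rightarrow> nat" where
  "avoiders_count n k \<pi> = card {\<sigma>. \<sigma> permutes {1..n} \<and> \<not> perm_contains n \<sigma> k \<pi>}"

text \<open>
  The constant \<open>lim\<close> carries information only for convergent sequences. This and
  the limit below exist for every \<open>k\<close>-permutation with \<open>k \<ge> 1\<close>, but that is a
  theorem (Marcus and Tardos, Arratia), not part of the definitions.
\<close>

definition stanley_wilf_limit :: "nat \<Rightarrow> (nat \<Rightarrow> nat) \<Rightarrow> real" where
  "stanley_wilf_limit k \<pi> = lim (\<lambda>n. root n (real (avoiders_count n k \<pi>)))"

definition binary_mat :: "nat mat \<Rightarrow> bool" where
  "binary_mat A \<longleftrightarrow> elements_mat A \<subseteq> {0, 1}"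

definition mat_contains :: "nat mat \<Rightarrow> nat mat \<Rightarrow> bool" where
  "mat_contains A P \<longleftrightarrow>
     (\<exists>I J. I \<subseteq> {..<dim_row A} \<and> card I = dim_row P \<and>
            J \<subseteq> {..<dim_col A} \<and> card J = dim_col P \<and>
            (\<forall>i<dim_row P. \<forall>j<dim_col P.
               P $$ (i, j) = 1 \<longrightarrow> submatrix A I J $$ (i, j) = 1))"

definition mass :: "nat mat \<Rightarrow> nat" where
  "mass A = card {(i, j). i < dim_row A \<and> j < dim_col A \<and> A $$ (i, j) = 1}"

text \<open>Matrix indices start at 0, whereas permutations act on \<open>{1..k}\<close>.\<close>

definition permutation_mat :: "nat \<Rightarrow> (nat \<Rightarrow> nat) \<Rightarrow> nat mat" where
  "permutation_mat k \<pi> = mat k k (\<lambda>(i, j). if \<pi> (Suc i) = Suc j then 1 else 0)"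

definition ex_mass :: "nat \<Rightarrow> nat \<Rightarrow> (nat \<Rightarrow> nat) \<Rightarrow> nat" where
  "ex_mass n k \<pi> =
     Max {mass A | A. A \<in> carrier_mat n n \<and> binary_mat A \<and>
                      \<not> mat_contains A (permutation_mat k \<pi>)}"

definition furedi_hajnal_limit :: "nat \<Rightarrow> (nat \<Rightarrow> nat) \<Rightarrow> real" where
  "furedi_hajnal_limit k \<pi> = lim (\<lambda>n. real (ex_mass n k \<pi>) / real n)"

end

theory Submission
  imports Defs
begin

text \<open>
  A matrix avoiding a \<open>k\<close>-permutation avoids the all-ones \<open>k \<times> k\<close> matrix as an interval minor,
  so both bounds only need to be proved for the latter. Cut an \<open>n \<times> n\<close> matrix into \<open>t \<times> t\<close> blocks
  with \<open>t = 4 ^ k\<close> and contract each block to an entry, following Marcus and Tardos. Blocks with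
  fewer than \<open>2 ^ (k - 1)\<close> nonempty rows and columns hold fewer than \<open>t / 4\<close> ones each, and Fox's
  halving argument shows that every block row and block column has only \<open>2 ^ O(k)\<close> other blocks.
  This gives mass at most \<open>c n\<close> with \<open>c = 2 ^ O(k)\<close>.

  For permutations, contract \<open>2 \<times> 2\<close> blocks repeatedly. Undoing one contraction costs a factor 16
  per one-entry. The number of ones at side length \<open>N\<close> is at most \<open>min n (c N)\<close>, so only
  \<open>log c = O(k)\<close> of the steps cost \<open>16 ^ n\<close> each and the remaining ones cost \<open>16 ^ O(n)\<close>
  altogether.

  Both limits exist by Fekete's lemma: a permutation cannot be decomposable both as a direct sum
  and as a skew sum, and the sum it is indecomposable for preserves avoidance.
\<close>

section \<open>Interval minors\<close>

text \<open>
  \<open>E\<close> contains the all-ones \<open>l \<times> k\<close> matrix as an interval minor; \<open>r\<close> and \<open>c\<close> are the breakpoints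
  of the strips. They increase because no cell is empty.
\<close>

definition has_grid :: "nat \<Rightarrow> nat \<Rightarrow> (nat \<times> nat) set \<Rightarrow> bool" where
  "has_grid l k E \<longleftrightarrow> (\<exists>r c :: nat \<Rightarrow> nat. \<forall>i<l. \<forall>j<k.
     \<exists>x y. (x, y) \<in> E \<and> x \<in> {r i..<r (Suc i)} \<and> y \<in> {c j..<c (Suc j)})"

lemma has_gridI:
  assumes "\<And>i j. i < l \<Longrightarrow> j < k \<Longrightarrow>
    \<exists>x y. (x, y) \<in> E \<and> x \<in> {r i..<r (Suc i)} \<and> y \<in> {c j..<c (Suc j)}"
  shows "has_grid l k E"
  unfolding has_grid_def using assms by (intro exI[of _ r] exI[of _ c]) simp

lemma has_gridE:
  assumes "has_grid l k E"
  obtains r c :: "nat \<Rightarrow> nat" where "\<forall>i<l. \<forall>j<k.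
    \<exists>x y. (x, y) \<in> E \<and> x \<in> {r i..<r (Suc i)} \<and> y \<in> {c j..<c (Suc j)}"
  using assms unfolding has_grid_def by (elim exE) (rule that)

lemma has_grid_mono: "has_grid l k E \<Longrightarrow> E \<subseteq> F \<Longrightarrow> has_grid l k F"
  unfolding has_grid_def by (meson subset_iff)

lemma has_grid_converse: "has_grid l k (E\<inverse>) \<longleftrightarrow> has_grid k l E"
proof -
  have "has_grid k l (E\<inverse>)" if E: "has_grid l k E" for l k and E :: "(nat \<times> nat) set"
  proof -
    obtain r c where "\<forall>i<l. \<forall>j<k.
        \<exists>x y. (x, y) \<in> E \<and> x \<in> {r i..<r (Suc i)} \<and> y \<in> {c j..<c (Suc j)}"
      using E by (rule has_gridE) (rule that)
    then show ?thesis
      by (intro has_gridI[where r = c and c = r]) blast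
  qed
  from this[of k l E] this[of l k "E\<inverse>"] show ?thesis by auto
qed

text \<open>Multiplying the breakpoints of a strip of blocks by the side length gives the strip of
  rows or columns that these blocks cover. Read contrapositively, contraction preserves
  grid-freeness; both the mass bound and the counting bound iterate this.\<close>

lemma has_grid_div_image:
  assumes "s > 0" "t > 0" and g: "has_grid l k ((\<lambda>(x, y). (x div s, y div t)) ` E)"
  shows "has_grid l k E"
proof -
  obtain r c where rc: "\<forall>i<l. \<forall>j<k.
    \<exists>x y. (x, y) \<in> (\<lambda>(x, y). (x div s, y div t)) ` E \<and>
      x \<in> {r i..<r (Suc i)} \<and> y \<in> {c j..<c (Suc j)}"
    using g by (rule has_gridE) (rule that)
  have *: "s * a \<le> x \<longleftrightarrow> a \<le> x div s" "x < s * a \<longleftrightarrow> x div s < a"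
    "t * a \<le> x \<longleftrightarrow> a \<le> x div t" "x < t * a \<longleftrightarrow> x div t < a" for a x
    using assms(1,2) by (simp_all add: less_eq_div_iff_mult_less_eq div_less_iff_less_mult mult.commute)
  show ?thesis
  proof (rule has_gridI)
    fix i j assume "i < l" "j < k"
    from rc[rule_format, OF this] obtain x y where "(x, y) \<in> E"
      "x div s \<in> {r i..<r (Suc i)}" "y div t \<in> {c j..<c (Suc j)}"
      by auto
    then show "\<exists>x y. (x, y) \<in> E \<and> x \<in> {s * r i..<s * r (Suc i)} \<and> y \<in> {t * c j..<t * c (Suc j)}"
      by (intro exI[of _ x] exI[of _ y]) (simp add: *)
  qed
qed

section \<open>Grids from many dense rows\<close>

lemma ex_increasing_selection:
  fixes X :: "nat set"
  assumes "finite X" "l \<le> card X"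
  shows "\<exists>r. \<forall>i<l. r i \<in> X \<and> r i < r (Suc i)"
proof -
  define xs where "xs = sorted_list_of_set X"
  have len: "length xs = card X" and set: "set xs = X" and s: "sorted_wrt (<) xs"
    using assms(1) by (auto simp: xs_def)
  \<comment> \<open>The default value is the breakpoint that closes the last strip when
    \<open>l = card X\<close>; it only has to exceed all of \<open>X\<close>.\<close>
  define r where "r i = (if i < length xs then xs ! i else Suc (Max X))" for i
  have "r i \<in> X \<and> r i < r (Suc i)" if "i < l" for i
  proof -
    have i: "i < length xs" using that assms(2) len by simp
    have "xs ! i \<in> X" using i set nth_mem by blast
    moreover have "xs ! i < Suc (Max X)"
      using calculation assms(1) by (simp add: less_Suc_eq_le)
    ultimately show ?thesis
      using i s by (auto simp: r_def sorted_wrt_iff_nth_less)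
  qed
  then show ?thesis by blast
qed

text \<open>Base case of the halving argument: the selected rows serve as breakpoints, so each row
  strip starts with a row of \<open>X\<close>.\<close>

lemma has_grid_one_column:
  fixes X :: "nat set"
  assumes "finite X" "l \<le> card X"
    and X: "\<And>x. x \<in> X \<Longrightarrow> \<exists>y. y \<in> {lo..<hi} \<and> (x, y) \<in> E"
  shows "has_grid l (Suc 0) (E \<inter> X \<times> {lo..<hi})"
proof -
  obtain r where r: "\<forall>i<l. r i \<in> X \<and> r i < r (Suc i)"
    using ex_increasing_selection[OF assms(1,2)] by blast
  define c where "c j = (if j = 0 then lo else hi)" for j :: nat
  show ?thesis
  proof (rule has_gridI)
    fix i j assume i: "i < l" and j: "j < Suc 0"
    obtain y where "y \<in> {lo..<hi}" "(r i, y) \<in> E"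
      using r i X by blast
    with i j r show "\<exists>x y. (x, y) \<in> E \<inter> X \<times> {lo..<hi} \<and>
        x \<in> {r i..<r (Suc i)} \<and> y \<in> {c j..<c (Suc j)}"
      by (intro exI[of _ "r i"] exI[of _ y]) (auto simp: c_def)
  qed
qed

text \<open>The given grid uses only rows of \<open>X\<close>, so every row strip contains a row of
  \<open>X\<close>; the one of that row in \<open>{mid..<hi}\<close> fills the cell of the new
  column strip.\<close>

lemma has_grid_extend_right:
  assumes g: "has_grid l (Suc k) (E \<inter> X \<times> {lo..<mid})"
    and X: "\<And>x. x \<in> X \<Longrightarrow> \<exists>y. y \<in> {mid..<hi} \<and> (x, y) \<in> E"
    and le: "lo \<le> mid" "mid \<le> hi"
  shows "has_grid l (Suc (Suc k)) (E \<inter> X \<times> {lo..<hi})"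
proof -
  obtain r c where rc: "\<forall>i<l. \<forall>j<Suc k.
      \<exists>x y. (x, y) \<in> E \<inter> X \<times> {lo..<mid} \<and> x \<in> {r i..<r (Suc i)} \<and> y \<in> {c j..<c (Suc j)}"
    using g by (rule has_gridE) (rule that)
  \<comment> \<open>The breakpoint \<open>c (Suc k)\<close> gives way to \<open>mid\<close>: the
    ones of the old last strip lie left of \<open>mid\<close> anyway.\<close>
  define c' where "c' j = (if j \<le> k then c j else if j = Suc k then mid else hi)" for j
  show ?thesis
  proof (rule has_gridI)
    fix i j assume i: "i < l" and j: "j < Suc (Suc k)"
    show "\<exists>x y. (x, y) \<in> E \<inter> X \<times> {lo..<hi} \<and> x \<in> {r i..<r (Suc i)} \<and> y \<in> {c' j..<c' (Suc j)}"
    proof (cases "j = Suc k")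
      case True
      obtain x where x: "x \<in> X" "x \<in> {r i..<r (Suc i)}"
        using rc[rule_format, OF i zero_less_Suc] by blast
      obtain y where "y \<in> {mid..<hi}" "(x, y) \<in> E" using X[OF x(1)] by blast
      with x True le show ?thesis by (intro exI[of _ x] exI[of _ y]) (simp add: c'_def)
    next
      case False
      then have "j < Suc k" using j by simp
      from rc[rule_format, OF i this] obtain x y where "(x, y) \<in> E \<inter> X \<times> {lo..<mid}"
        "x \<in> {r i..<r (Suc i)}" "y \<in> {c j..<c (Suc j)}" by blast
      with \<open>j < Suc k\<close> le show ?thesis by (intro exI[of _ x] exI[of _ y]) (auto simp: c'_def)
    qed
  qed
qed

lemma has_grid_extend_left:
  assumes g: "has_grid l (Suc k) (E \<inter> X \<times> {mid..<hi})"
    and X: "\<And>x. x \<in> X \<Longrightarrow> \<exists>y. y \<in> {lo..<mid} \<and> (x, y) \<in> E"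
    and le: "lo \<le> mid" "mid \<le> hi"
  shows "has_grid l (Suc (Suc k)) (E \<inter> X \<times> {lo..<hi})"
proof -
  obtain r c where rc: "\<forall>i<l. \<forall>j<Suc k.
      \<exists>x y. (x, y) \<in> E \<inter> X \<times> {mid..<hi} \<and> x \<in> {r i..<r (Suc i)} \<and> y \<in> {c j..<c (Suc j)}"
    using g by (rule has_gridE) (rule that)
  \<comment> \<open>Here \<open>mid\<close> takes the place of the old first breakpoint
    \<open>c 0\<close>, since no one of the old grid lies left of it.\<close>
  define c' where "c' j = (if j = 0 then lo else if j = 1 then mid else c (j - 1))" for j
  show ?thesis
  proof (rule has_gridI)
    fix i j assume i: "i < l" and j: "j < Suc (Suc k)"
    show "\<exists>x y. (x, y) \<in> E \<inter> X \<times> {lo..<hi} \<and> x \<in> {r i..<r (Suc i)} \<and> y \<in> {c' j..<c' (Suc j)}"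
    proof (cases j)
      case 0
      obtain x where x: "x \<in> X" "x \<in> {r i..<r (Suc i)}"
        using rc[rule_format, OF i zero_less_Suc] by blast
      obtain y where "y \<in> {lo..<mid}" "(x, y) \<in> E" using X[OF x(1)] by blast
      with x 0 le show ?thesis by (intro exI[of _ x] exI[of _ y]) (simp add: c'_def)
    next
      case (Suc j')
      then have "j' < Suc k" using j by simp
      from rc[rule_format, OF i this] obtain x y where "(x, y) \<in> E \<inter> X \<times> {mid..<hi}"
        "x \<in> {r i..<r (Suc i)}" "y \<in> {c j'..<c (Suc j')}" by blast
      with Suc le show ?thesis by (intro exI[of _ x] exI[of _ y]) (auto simp: c'_def)
    qed
  qed
qed

text \<open>
  Halve the columns. A row has all its ones on one side, or it has at least half of them on one
  side and some on the other, where they supply an additional column strip. One of these four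
  kinds makes up a quarter of the rows, hence the factor \<open>4 ^ a\<close>.
\<close>

lemma has_grid_of_many_dense_rows:
  fixes X :: "nat set"
  assumes "finite X" "l * 4 ^ a < card X"
    and "\<And>x. x \<in> X \<Longrightarrow> 2 ^ k \<le> card {y \<in> {lo..<lo + 2 ^ a}. (x, y) \<in> E}"
  shows "has_grid l (Suc k) (E \<inter> X \<times> {lo..<lo + 2 ^ a})"
  using assms
proof (induction a arbitrary: k lo X)
  case 0
  have "k = 0"
  proof -
    obtain x where "x \<in> X" using 0(2) by (metis card.empty equals0I not_less0)
    then have "2 ^ k \<le> card {y \<in> {lo..<lo + 1}. (x, y) \<in> E}" using 0(3) by simp
    also have "\<dots> \<le> card {lo..<lo + 1}" by (intro card_mono) auto
    finally have "(2::nat) ^ k \<le> 2 ^ 0" by simp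
    then show ?thesis by (simp only: power_increasing_iff)
  qed
  show ?case
    unfolding \<open>k = 0\<close>
  proof (rule has_grid_one_column[OF 0(1)])
    show "\<exists>y. y \<in> {lo..<lo + 2 ^ 0} \<and> (x, y) \<in> E" if "x \<in> X" for x
      using 0(3)[OF that] by (intro exI[of _ lo]) (auto simp: \<open>k = 0\<close> Suc_le_eq card_gt_0_iff)
  qed (use 0(2) in simp)
next
  case (Suc a)
  define mid hi where "mid = lo + (2::nat) ^ a" and "hi = lo + (2::nat) ^ Suc a"
  have hi: "hi = mid + 2 ^ a" by (simp add: mid_def hi_def)
  have le: "lo \<le> mid" "mid \<le> hi" by (auto simp: mid_def hi)
  define L where "L x = {y \<in> {lo..<mid}. (x, y) \<in> E}" for x
  define R where "R x = {y \<in> {mid..<hi}. (x, y) \<in> E}" for x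
  have fin: "finite (L x)" "finite (R x)" for x by (auto simp: L_def R_def)
  have LR: "card {y \<in> {lo..<hi}. (x, y) \<in> E} = card (L x) + card (R x)" for x
  proof -
    have "{y \<in> {lo..<hi}. (x, y) \<in> E} = L x \<union> R x" "L x \<inter> R x = {}"
      using le by (auto simp: L_def R_def)
    then show ?thesis using fin by (simp add: card_Un_disjoint)
  qed
  have big: "2 ^ k \<le> card (L x) + card (R x)" if "x \<in> X" for x
    using Suc.prems(3)[OF that] LR unfolding hi_def by simp
  show ?case
  proof (cases k)
    case 0
    have "\<exists>y. y \<in> {lo..<hi} \<and> (x, y) \<in> E" if "x \<in> X" for x
    proof -
      have "{y \<in> {lo..<hi}. (x, y) \<in> E} \<noteq> {}"
        using Suc.prems(3)[OF that] 0 unfolding hi_def[symmetric]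
          by (metis card.empty not_one_le_zero power_0)
      then show ?thesis by blast
    qed
    moreover have "l \<le> card X"
      using Suc.prems(2) order.trans[of l "l * 4 ^ Suc a" "card X"] by simp
    ultimately show ?thesis
      using has_grid_one_column[OF Suc.prems(1), of l lo hi E] 0 by (simp add: hi_def)
  next
    case (Suc k')
    define X1 where "X1 = {x \<in> X. R x = {}}"
    define X2 where "X2 = {x \<in> X. L x = {}}"
    define X3 where "X3 = {x \<in> X. 2 ^ k' \<le> card (L x) \<and> R x \<noteq> {}}"
    define X4 where "X4 = {x \<in> X. 2 ^ k' \<le> card (R x) \<and> L x \<noteq> {}}"
    \<comment> \<open>If both halves of a row contain ones, the fuller half has at least half of the
      \<open>2 ^ Suc k'\<close> ones.\<close>
    have "X \<subseteq> X1 \<union> X2 \<union> X3 \<union> X4"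
    proof
      fix x assume "x \<in> X"
      with big[OF this] show "x \<in> X1 \<union> X2 \<union> X3 \<union> X4"
        by (auto simp: X1_def X2_def X3_def X4_def Suc)
    qed
    then have "card X \<le> card (X1 \<union> X2 \<union> X3 \<union> X4)"
      using \<open>finite X\<close> by (intro card_mono) (auto simp: X1_def X2_def X3_def X4_def)
    also have "\<dots> \<le> card X1 + card X2 + card X3 + card X4"
      using card_Un_le[of "X1 \<union> X2 \<union> X3" X4] card_Un_le[of "X1 \<union> X2" X3] card_Un_le[of X1 X2]
      by linarith
    finally have "l * 4 ^ a < card X1 \<or> l * 4 ^ a < card X2 \<or> l * 4 ^ a < card X3 \<or> l * 4 ^ a < card X4"
      using Suc.prems(2) by auto
    moreover have sub: "X1 \<subseteq> X" "X2 \<subseteq> X" "X3 \<subseteq> X" "X4 \<subseteq> X"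
      by (auto simp: X1_def X2_def X3_def X4_def)
    have finX: "finite X1" "finite X2" "finite X3" "finite X4"
      using sub \<open>finite X\<close> finite_subset by blast+
    \<comment> \<open>Rows in \<open>X1\<close> and \<open>X2\<close> keep all their ones in one
      half, so the induction hypothesis applies with the same \<open>k\<close>. For
      \<open>X3\<close> and \<open>X4\<close> it applies with \<open>k'\<close>, and the other half
      supplies the missing strip.\<close>
    note IHL = Suc.IH[where lo = lo, folded mid_def, folded L_def]
    note IHR = Suc.IH[where lo = mid, folded hi, folded R_def]
    have ?thesis if "l * 4 ^ a < card X1"
    proof -
      have "has_grid l (Suc k) (E \<inter> X1 \<times> {lo..<mid})"
        using big sub by (intro IHL finX that) (fastforce simp: X1_def)
      then show ?thesis
        by (rule has_grid_mono) (unfold hi_def[symmetric], use sub le in auto)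
    qed
    moreover have ?thesis if "l * 4 ^ a < card X2"
    proof -
      have "has_grid l (Suc k) (E \<inter> X2 \<times> {mid..<hi})"
        using big sub by (intro IHR finX that) (fastforce simp: X2_def)
      then show ?thesis
        by (rule has_grid_mono) (unfold hi_def[symmetric], use sub le in auto)
    qed
    moreover have ?thesis if "l * 4 ^ a < card X3"
    proof -
      have "has_grid l (Suc k') (E \<inter> X3 \<times> {lo..<mid})"
        by (intro IHL finX that) (auto simp: X3_def)
      then have "has_grid l (Suc k) (E \<inter> X3 \<times> {lo..<hi})"
        unfolding Suc by (rule has_grid_extend_right) (use le in \<open>auto simp: X3_def R_def\<close>)
      then show ?thesis
        by (rule has_grid_mono) (unfold hi_def[symmetric], use sub in auto)
    qed
    moreover have ?thesis if "l * 4 ^ a < card X4"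
    proof -
      have "has_grid l (Suc k') (E \<inter> X4 \<times> {mid..<hi})"
        by (intro IHR finX that) (auto simp: X4_def)
      then have "has_grid l (Suc k) (E \<inter> X4 \<times> {lo..<hi})"
        unfolding Suc by (rule has_grid_extend_left) (use le in \<open>auto simp: X4_def L_def\<close>)
      then show ?thesis
        by (rule has_grid_mono) (unfold hi_def[symmetric], use sub in auto)
    qed
    ultimately show ?thesis by blast
  qed
qed

section \<open>The mass of a grid-free set\<close>

definition block :: "nat \<Rightarrow> (nat \<times> nat) set \<Rightarrow> nat \<Rightarrow> nat \<Rightarrow> (nat \<times> nat) set" where
  "block t E p q = {(x, y) \<in> E. x div t = p \<and> y div t = q}"

lemma div_eq_iff_mem:
  fixes t :: nat
  assumes "t > 0"
  shows "y div t = q \<longleftrightarrow> y \<in> {q * t..<q * t + t}"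
proof
  show "y \<in> {q * t..<q * t + t}" if "y div t = q"
    using that assms dividend_less_div_times[of t y] by (auto simp: add.commute)
  show "y div t = q" if "y \<in> {q * t..<q * t + t}"
    using that by (intro div_nat_eqI) (auto simp: mult.commute)
qed

text \<open>Contract each block row to a single row and leave the columns alone. Inside block column
  \<open>q\<close>, the ones of row \<open>p\<close> then sit in exactly the nonempty columns of
  block \<open>(p, q)\<close>. Wide blocks thus become dense rows, and too many of them give a grid
  that lifts back to \<open>E\<close>.\<close>

lemma card_wide_in_block_column:
  assumes "finite P" "\<not> has_grid l (Suc k) E"
  shows "card {p \<in> P. 2 ^ k \<le> card (snd ` block (2 ^ a) E p q)} \<le> l * 4 ^ a"
proof (rule ccontr)
  define X where "X = {p \<in> P. 2 ^ k \<le> card (snd ` block (2 ^ a) E p q)}"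
  \<comment> \<open>Division by 1 puts the row contraction into the form of
    \<open>has_grid_div_image\<close>.\<close>
  define E' where "E' = (\<lambda>(x, y). (x div 2 ^ a, y div 1)) ` E"
  have "finite X" using assms(1) by (simp add: X_def)
  moreover assume "\<not> card {p \<in> P. 2 ^ k \<le> card (snd ` block (2 ^ a) E p q)} \<le> l * 4 ^ a"
  then have "l * 4 ^ a < card X" by (simp add: X_def)
  moreover have "2 ^ k \<le> card {y \<in> {q * 2 ^ a..<q * 2 ^ a + 2 ^ a}. (p, y) \<in> E'}" if "p \<in> X" for p
  proof -
    have "snd ` block (2 ^ a) E p q = {y. y div 2 ^ a = q \<and> (p, y) \<in> E'}"
      by (force simp: block_def E'_def)
    then show ?thesis using that by (simp add: X_def div_eq_iff_mem)
  qed
  ultimately have "has_grid l (Suc k) (E' \<inter> X \<times> {q * 2 ^ a..<q * 2 ^ a + 2 ^ a})"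
    by (intro has_grid_of_many_dense_rows)
  then have "has_grid l (Suc k) E'" by (rule has_grid_mono) auto
  then have "has_grid l (Suc k) E" unfolding E'_def by (rule has_grid_div_image[rotated 2]) auto
  with assms(2) show False ..
qed

lemma card_wide_blocks:
  assumes "B \<subseteq> {..<N} \<times> {..<N}" "\<not> has_grid l (Suc k) E"
  shows "card {(p, q) \<in> B. 2 ^ k \<le> card (snd ` block (2 ^ a) E p q)} \<le> N * (l * 4 ^ a)"
proof -
  define W where "W q = {p \<in> {..<N}. 2 ^ k \<le> card (snd ` block (2 ^ a) E p q)}" for q
  have fin: "finite (W q)" for q by (simp add: W_def)
  have "{(p, q) \<in> B. 2 ^ k \<le> card (snd ` block (2 ^ a) E p q)} \<subseteq> (\<Union>q<N. (\<lambda>p. (p, q)) ` W q)"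
    using assms(1) by (auto simp: W_def)
  then have "card {(p, q) \<in> B. 2 ^ k \<le> card (snd ` block (2 ^ a) E p q)}
      \<le> card (\<Union>q<N. (\<lambda>p. (p, q)) ` W q)"
    using fin by (intro card_mono) auto
  also have "\<dots> \<le> (\<Sum>q<N. card ((\<lambda>p. (p, q)) ` W q))"
    by (intro card_UN_le) auto
  also have "\<dots> \<le> (\<Sum>q<N. card (W q))"
    using fin by (intro sum_mono card_image_le)
  also have "\<dots> \<le> (\<Sum>q<N. l * 4 ^ a)"
    unfolding W_def using assms(2) by (intro sum_mono card_wide_in_block_column) auto
  finally show ?thesis by simp
qed

text \<open>A tall block of \<open>E\<close> is a wide block of the converse, where the two grid
  dimensions also trade places.\<close>

lemma card_tall_blocks:
  assumes "B \<subseteq> {..<N} \<times> {..<N}" "\<not> has_grid (Suc k) l E"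
  shows "card {(p, q) \<in> B. 2 ^ k \<le> card (fst ` block (2 ^ a) E p q)} \<le> N * (l * 4 ^ a)"
proof -
  have "fst ` block (2 ^ a) E p q = snd ` block (2 ^ a) (E\<inverse>) q p" for p q
    by (force simp: block_def)
  then have "{(p, q) \<in> B. 2 ^ k \<le> card (fst ` block (2 ^ a) E p q)}
      = {(q, p) \<in> B\<inverse>. 2 ^ k \<le> card (snd ` block (2 ^ a) (E\<inverse>) q p)}\<inverse>"
    by auto
  moreover have "B\<inverse> \<subseteq> {..<N} \<times> {..<N}" using assms(1) by auto
  ultimately show ?thesis
    using card_wide_blocks[of "B\<inverse>" N l k "E\<inverse>" a] assms(2) by (simp add: has_grid_converse)
qed

lemma card_block_le:
  assumes "finite E" "t > 0"
  shows "card (block t E p q) \<le> t ^ 2"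
    and "card (block t E p q) \<le> card (fst ` block t E p q) * card (snd ` block t E p q)"
proof -
  have "finite (block t E p q)"
    by (rule finite_subset[OF _ assms(1)]) (auto simp: block_def)
  then show *: "card (block t E p q) \<le> card (fst ` block t E p q) * card (snd ` block t E p q)"
    unfolding card_cartesian_product[symmetric]
    by (intro card_mono) (auto intro: rev_image_eqI)
  have "fst ` block t E p q \<subseteq> {p * t..<p * t + t}" "snd ` block t E p q \<subseteq> {q * t..<q * t + t}"
    using div_eq_iff_mem[OF assms(2)] by (auto simp: block_def)
  from this[THEN card_mono[rotated]]
  have "card (fst ` block t E p q) \<le> t" "card (snd ` block t E p q) \<le> t"
    by simp_all
  then show "card (block t E p q) \<le> t ^ 2"
    unfolding power2_eq_square using * mult_le_mono order_trans by blast
qed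

text \<open>One contraction step of the mass bound. A wide or tall block is charged its full area
  \<open>4 ^ a\<close>, and there are few of these. Every other nonempty block lies in the product
  of fewer than \<open>2 ^ k\<close> rows with fewer than \<open>2 ^ k\<close> columns, hence the
  \<open>4 ^ k\<close>.\<close>

lemma card_grid_free_step:
  assumes E: "E \<subseteq> {..<2 ^ a * N} \<times> {..<2 ^ a * N}" and free: "\<not> has_grid (Suc k) (Suc k) E"
  defines "B \<equiv> (\<lambda>(x, y). (x div 2 ^ a, y div 2 ^ a)) ` E"
  shows "card E \<le> 4 ^ k * card B + 2 * (4 ^ a * (N * (Suc k * 4 ^ a)))"
proof -
  define t :: nat where "t = 2 ^ a"
  have "t > 0" by (simp add: t_def)
  have fin: "finite E" using E finite_subset by blast
  then have "finite B" by (simp add: B_def)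
  have B: "B \<subseteq> {..<N} \<times> {..<N}"
    using E \<open>t > 0\<close> by (auto simp: B_def t_def[symmetric] div_less_iff_less_mult mult.commute)
  define W where "W = {(p, q) \<in> B. 2 ^ k \<le> card (snd ` block t E p q)}"
  define T where "T = {(p, q) \<in> B. 2 ^ k \<le> card (fst ` block t E p q)}"
  have "card W \<le> N * (Suc k * 4 ^ a)"
    unfolding W_def t_def by (rule card_wide_blocks[OF B free])
  then have W: "4 ^ a * card W \<le> 4 ^ a * (N * (Suc k * 4 ^ a))" by (rule mult_le_mono2)
  have "card T \<le> N * (Suc k * 4 ^ a)"
    unfolding T_def t_def by (rule card_tall_blocks[OF B free])
  then have T: "4 ^ a * card T \<le> 4 ^ a * (N * (Suc k * 4 ^ a))" by (rule mult_le_mono2)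
  have "card E \<le> 4 ^ k * card B + 4 ^ a * card W + 4 ^ a * card T"
  proof -
    have t2: "t ^ 2 = 4 ^ a" by (simp add: t_def power2_eq_square flip: power_mult_distrib)
    have sub: "W \<subseteq> B" "T \<subseteq> B" by (auto simp: W_def T_def)
    have "E \<subseteq> (\<Union>(p, q)\<in>B. block t E p q)"
      by (force simp: B_def block_def t_def)
    then have "card E \<le> card (\<Union>(p, q)\<in>B. block t E p q)"
      using \<open>finite B\<close> fin
      by (intro card_mono) (auto intro: finite_subset[of _ E] simp: block_def)
    also have "\<dots> \<le> (\<Sum>(p, q)\<in>B. card (block t E p q))"
      using card_UN_le[OF \<open>finite B\<close>, of "\<lambda>(p, q). block t E p q"] by (simp add: case_prod_unfold)
    also have "\<dots> \<le> (\<Sum>b\<in>B. 4 ^ k + (if b \<in> W then 4 ^ a else 0) + (if b \<in> T then 4 ^ a else 0))"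
    proof (intro sum_mono, clarify)
      fix p q assume "(p, q) \<in> B"
      show "card (block t E p q) \<le> 4 ^ k + (if (p, q) \<in> W then 4 ^ a else 0)
        + (if (p, q) \<in> T then 4 ^ a else 0)"
      proof (cases "(p, q) \<in> W \<or> (p, q) \<in> T")
        case True
        with card_block_le(1)[OF fin \<open>t > 0\<close>, of p q] show ?thesis unfolding t2 by auto
      next
        case False
        then have "card (fst ` block t E p q) \<le> 2 ^ k" "card (snd ` block t E p q) \<le> 2 ^ k"
          using \<open>(p, q) \<in> B\<close> by (auto simp: W_def T_def)
        then have "card (fst ` block t E p q) * card (snd ` block t E p q) \<le> 2 ^ k * 2 ^ k"
          by (rule mult_le_mono)
        also have "\<dots> = 4 ^ k" by (simp flip: power_mult_distrib)
        finally show ?thesis using card_block_le(2)[OF fin \<open>t > 0\<close>, of p q] by simp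
      qed
    qed
    also have "\<dots> = 4 ^ k * card B + 4 ^ a * card W + 4 ^ a * card T"
      using \<open>finite B\<close> sub by (simp add: sum.distrib sum.If_cases Int_absorb1 mult.commute)
    finally show ?thesis .
  qed
  with W T show ?thesis by linarith
qed

text \<open>With blocks of side \<open>4 ^ K\<close>, an ordinary block holds at most
  \<open>4 ^ (K - 1)\<close> ones, a quarter of its side length. So the ordinary blocks use up a
  quarter of the linear bound and leave the rest for the exceptional ones.\<close>

lemma card_grid_free_power:
  assumes "K > 0" "E \<subseteq> {..<4 ^ (K * m)} \<times> {..<4 ^ (K * m)}" "\<not> has_grid K K E"
  shows "card E \<le> 2 ^ (9 * K) * 4 ^ (K * m)"
  using assms(2,3)
proof (induction m arbitrary: E)
  case 0
  then have "card E \<le> card ({..<1::nat} \<times> {..<1::nat})" by (intro card_mono) auto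
  also have "\<dots> \<le> 2 ^ (9 * K) * 4 ^ (K * 0)" by simp
  finally show ?case .
next
  case (Suc m)
  obtain k where K: "K = Suc k" using assms(1) gr0_conv_Suc by blast
  define N :: nat where "N = 4 ^ (K * m)"
  define c :: nat where "c = 2 ^ (9 * K)"
  define B where "B = (\<lambda>(x, y). (x div 2 ^ (2 * K), y div 2 ^ (2 * K))) ` E"
  have dim: "4 ^ (K * Suc m) = 2 ^ (2 * K) * N"
    by (simp add: N_def power_add power_mult)
  have B: "B \<subseteq> {..<4 ^ (K * m)} \<times> {..<4 ^ (K * m)}"
    using Suc.prems(1) unfolding dim N_def[symmetric]
    by (auto simp: B_def div_less_iff_less_mult mult.commute)
  have "\<not> has_grid K K B"
    using Suc.prems(2) has_grid_div_image[of "2 ^ (2 * K)" "2 ^ (2 * K)" K K E] by (auto simp: B_def)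
  then have cB: "card B \<le> c * N" using Suc.IH[OF B] by (simp add: c_def N_def)
  have "card E \<le> 4 ^ k * card B + 2 * (4 ^ (2 * K) * (N * (K * 4 ^ (2 * K))))"
    using card_grid_free_step[of E "2 * K" N k] Suc.prems
    unfolding dim K[symmetric] B_def by simp
  also have "\<dots> \<le> 4 ^ k * (c * N) + N * c"
  proof (rule add_mono)
    \<comment> \<open>The exceptional blocks contribute \<open>2 * K * 2 ^ (8 * K) * N\<close>, and
      \<open>2 * K \<le> 2 ^ K\<close> absorbs the linear factor; this fixes the exponent
      \<open>9 * K\<close>.\<close>
    have "2 * K \<le> 2 ^ K"
      using K by (induction k arbitrary: K) auto
    then have "2 * K * 2 ^ (8 * K) \<le> 2 ^ K * 2 ^ (8 * K)" by (rule mult_le_mono1)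
    also have "\<dots> = c" by (simp add: c_def flip: power_add)
    finally have "2 * K * 2 ^ (8 * K) * N \<le> c * N" by (rule mult_le_mono1)
    moreover have "(4::nat) ^ (2 * K) * 4 ^ (2 * K) = 2 ^ (8 * K)"
      by (simp add: power_mult flip: power_mult_distrib)
    ultimately show "2 * (4 ^ (2 * K) * (N * (K * 4 ^ (2 * K)))) \<le> N * c"
      by (simp add: algebra_simps)
  qed (use cB in simp)
  \<comment> \<open>Since \<open>4 ^ K\<close> is four times \<open>4 ^ k\<close>, there is room for
    the additional \<open>N * c\<close>.\<close>
  also have "\<dots> \<le> 4 ^ K * (c * N)"
    unfolding K by (simp add: algebra_simps)
  also have "\<dots> = 2 ^ (9 * K) * 4 ^ (K * Suc m)"
    by (simp add: c_def N_def power_add algebra_simps)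
  finally show ?case .
qed

text \<open>Enlarging the side to the next power of \<open>4 ^ K\<close> costs a factor of at most
  \<open>4 ^ K = 2 ^ (2 * K)\<close>, which turns \<open>9 * K\<close> into
  \<open>11 * K\<close>.\<close>

lemma card_grid_free:
  assumes "K > 0" "N > 0" "E \<subseteq> {..<N} \<times> {..<N}" "\<not> has_grid K K E"
  shows "card E \<le> 2 ^ (11 * K) * N"
proof -
  define t :: nat where "t = 4 ^ K"
  have "1 < t" using assms(1) by (simp add: t_def del: One_nat_def)
  then obtain m where m: "t ^ m \<le> N" "N < t ^ Suc m"
    using ex_power_ivl1[of t N] assms(2) by auto
  have "E \<subseteq> {..<4 ^ (K * Suc m)} \<times> {..<4 ^ (K * Suc m)}"
  proof -
    have "N < 4 ^ (K * Suc m)" using m(2) by (simp only: t_def power_mult)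
    then have "{..<N} \<subseteq> {..<4 ^ (K * Suc m)}" by auto
    then show ?thesis by (intro order_trans[OF assms(3)] Sigma_mono)
  qed
  from card_grid_free_power[OF assms(1) this assms(4)]
  have "card E \<le> 2 ^ (9 * K) * t * t ^ m"
    by (simp add: t_def power_add power_mult)
  also have "\<dots> \<le> 2 ^ (9 * K) * t * N" using m(1) by simp
  also have "2 ^ (9 * K) * t = 2 ^ (11 * K)"
    by (simp add: t_def power_mult flip: power_mult_distrib)
  finally show ?thesis .
qed

section \<open>The number of sparse grid-free sets\<close>

definition halve :: "nat \<times> nat \<Rightarrow> nat \<times> nat" where
  "halve = (\<lambda>(x, y). (x div 2, y div 2))"

text \<open>Every such \<open>E\<close> is a subset of the preimage of \<open>F\<close>, which has
  four points over each point of \<open>F\<close>.\<close>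

lemma
  assumes "finite F"
  shows finite_halve_preimages: "finite {E. halve ` E = F}"
    and card_halve_preimages: "card {E. halve ` E = F} \<le> 16 ^ card F"
proof -
  have cell: "halve -` {z} = {2 * fst z, 2 * fst z + 1} \<times> {2 * snd z, 2 * snd z + 1}" for z
    by (cases z) (auto simp: halve_def)
  have fin: "finite (halve -` F)"
    using assms unfolding vimage_eq_UN[of halve F] cell by simp
  have sub: "{E. halve ` E = F} \<subseteq> Pow (halve -` F)" by auto
  show "finite {E. halve ` E = F}" using sub fin by (simp add: finite_subset)
  have "card (halve -` F) \<le> (\<Sum>z\<in>F. card (halve -` {z}))"
    using card_UN_le[OF assms, of "\<lambda>z. halve -` {z}"] by (simp flip: vimage_eq_UN)
  also have "\<dots> = 4 * card F" by (simp add: cell card_cartesian_product)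
  finally have "card (halve -` F) \<le> 4 * card F" .
  have "card {E. halve ` E = F} \<le> 2 ^ card (halve -` F)"
    using card_mono[OF _ sub] fin by (simp add: card_Pow)
  also have "\<dots> \<le> 2 ^ (4 * card F)"
    using \<open>card (halve -` F) \<le> 4 * card F\<close> by (intro power_increasing) auto
  also have "\<dots> = 16 ^ card F" by (simp add: power_mult)
  finally show "card {E. halve ` E = F} \<le> 16 ^ card F" .
qed

lemma card_halve_family:
  assumes "finite \<F>" "(`) halve ` \<E> \<subseteq> \<F>"
    and "\<And>F. F \<in> \<F> \<Longrightarrow> finite F" "\<And>F. F \<in> \<F> \<Longrightarrow> card F \<le> u"
  shows "card \<E> \<le> card \<F> * 16 ^ u"
proof -
  have "card \<E> \<le> card (\<Union>F\<in>\<F>. {E. halve ` E = F})"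
    using assms(1-3) finite_halve_preimages by (intro card_mono finite_UN_I) auto
  also have "\<dots> \<le> (\<Sum>F\<in>\<F>. card {E. halve ` E = F})"
    by (intro card_UN_le assms(1))
  also have "\<dots> \<le> (\<Sum>F\<in>\<F>. 16 ^ u)"
  proof (intro sum_mono)
    fix F assume F: "F \<in> \<F>"
    have "card {E. halve ` E = F} \<le> 16 ^ card F"
      using assms(3)[OF F] by (rule card_halve_preimages)
    also have "\<dots> \<le> 16 ^ u" using assms(4)[OF F] by (intro power_increasing) auto
    finally show "card {E. halve ` E = F} \<le> 16 ^ u" .
  qed
  finally show ?thesis by simp
qed

text \<open>The cardinality is bounded by \<open>n\<close> instead of being equal to it because
  halving may merge ones; in this form halving carries the family for \<open>Suc d\<close> into the
  family for \<open>d\<close>.\<close>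

definition grid_free_sets :: "nat \<Rightarrow> nat \<Rightarrow> nat \<Rightarrow> (nat \<times> nat) set set" where
  "grid_free_sets K n d = {E. E \<subseteq> {..<2 ^ d} \<times> {..<2 ^ d} \<and> card E \<le> n \<and> \<not> has_grid K K E}"

lemma finite_grid_free_sets: "finite (grid_free_sets K n d)"
  by (rule finite_subset[of _ "Pow ({..<2 ^ d} \<times> {..<2 ^ d})"]) (auto simp: grid_free_sets_def)

lemma finite_of_mem_grid_free_sets: "F \<in> grid_free_sets K n d \<Longrightarrow> finite F"
  by (auto simp: grid_free_sets_def intro: finite_subset)

lemma halve_grid_free_sets: "(`) halve ` grid_free_sets K n (Suc d) \<subseteq> grid_free_sets K n d"
proof
  fix F assume "F \<in> (`) halve ` grid_free_sets K n (Suc d)"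
  then obtain E where E: "E \<in> grid_free_sets K n (Suc d)" and F: "F = halve ` E" by blast
  have "F \<subseteq> {..<2 ^ d} \<times> {..<2 ^ d}"
    using E by (auto simp: F grid_free_sets_def halve_def div_less_iff_less_mult mult.commute)
  moreover have "card F \<le> n"
    using E card_image_le[OF finite_of_mem_grid_free_sets[OF E], of halve]
    by (auto simp: F grid_free_sets_def)
  moreover have "\<not> has_grid K K F"
    using E has_grid_div_image[of 2 2 K K E] by (auto simp: F grid_free_sets_def halve_def)
  ultimately show "F \<in> grid_free_sets K n d" by (simp add: grid_free_sets_def)
qed

lemma card_grid_free_sets_Suc:
  assumes "K > 0"
  shows "card (grid_free_sets K n (Suc d)) \<le> card (grid_free_sets K n d) * 16 ^ min n (2 ^ (11 * K) * 2 ^ d)"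
proof (rule card_halve_family[OF finite_grid_free_sets halve_grid_free_sets finite_of_mem_grid_free_sets])
  show "card F \<le> min n (2 ^ (11 * K) * 2 ^ d)" if "F \<in> grid_free_sets K n d" for F
    using that card_grid_free[OF assms, of "2 ^ d" F] by (auto simp: grid_free_sets_def)
qed

text \<open>The exponents \<open>2 ^ (11 * K) * 2 ^ i\<close> for \<open>i < d\<close> form a
  geometric sum below \<open>2 ^ (11 * K) * 2 ^ d\<close>. The factor 2 counts the two subsets of a
  single cell.\<close>

lemma card_grid_free_sets_coarse:
  assumes "K > 0"
  shows "card (grid_free_sets K n d) \<le> 2 * 16 ^ (2 ^ (11 * K) * 2 ^ d)"
proof (induction d)
  case 0
  have "card (grid_free_sets K n 0) \<le> card (Pow ({..<1::nat} \<times> {..<1::nat}))"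
    by (intro card_mono) (auto simp: grid_free_sets_def)
  also have "\<dots> = 2 * 1" by (simp add: card_Pow)
  also have "\<dots> \<le> 2 * 16 ^ (2 ^ (11 * K) * 2 ^ 0)" by (intro mult_le_mono2) simp
  finally show ?case .
next
  case (Suc d)
  have "card (grid_free_sets K n (Suc d)) \<le> card (grid_free_sets K n d) * 16 ^ min n (2 ^ (11 * K) * 2 ^ d)"
    by (rule card_grid_free_sets_Suc[OF assms])
  also have "\<dots> \<le> (2 * 16 ^ (2 ^ (11 * K) * 2 ^ d)) * 16 ^ (2 ^ (11 * K) * 2 ^ d)"
    by (intro mult_le_mono Suc.IH power_increasing) auto
  also have "\<dots> = 2 * 16 ^ (2 ^ (11 * K) * 2 ^ Suc d)"
    by (simp flip: power_add mult_2)
  finally show ?case .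
qed

text \<open>This charges \<open>n\<close> at every step, the better choice once
  \<open>2 ^ (11 * K) * 2 ^ d\<close> exceeds \<open>n\<close>.\<close>

lemma card_grid_free_sets_fine:
  assumes "K > 0"
  shows "card (grid_free_sets K n (d + e)) \<le> card (grid_free_sets K n d) * 16 ^ (n * e)"
proof (induction e)
  case (Suc e)
  have "card (grid_free_sets K n (d + Suc e)) \<le> card (grid_free_sets K n (d + e)) * 16 ^ min n (2 ^ (11 * K) * 2 ^ (d + e))"
    using card_grid_free_sets_Suc[OF assms] by simp
  also have "\<dots> \<le> (card (grid_free_sets K n d) * 16 ^ (n * e)) * 16 ^ n"
    by (intro mult_le_mono Suc.IH power_increasing) auto
  also have "\<dots> = card (grid_free_sets K n d) * 16 ^ (n * Suc e)" by (simp add: power_add)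
  finally show ?case .
qed simp

text \<open>The coarse estimate is used up to side length \<open>2 ^ (m - 11 * K)\<close>, where its
  exponent is \<open>2 ^ m\<close>, at most \<open>2 * n\<close>; the last \<open>11 * K\<close>
  steps cost \<open>16 ^ n\<close> each. For \<open>m < 11 * K\<close> every step is charged
  \<open>16 ^ n\<close>.\<close>

lemma card_grid_free_sets_sparse:
  assumes "K > 0" "n > 0" "2 ^ m \<le> 2 * n"
  shows "card (grid_free_sets K n m) \<le> 2 ^ (56 * K * n)"
proof -
  have "card (grid_free_sets K n m) \<le> 2 * 16 ^ ((11 * K + 2) * n)"
  proof (cases "11 * K \<le> m")
    case True
    have "card (grid_free_sets K n m) = card (grid_free_sets K n ((m - 11 * K) + 11 * K))" using True by simp
    also have "\<dots> \<le> card (grid_free_sets K n (m - 11 * K)) * 16 ^ (n * (11 * K))"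
      by (rule card_grid_free_sets_fine[OF assms(1)])
    also have "\<dots> \<le> (2 * 16 ^ (2 ^ (11 * K) * 2 ^ (m - 11 * K))) * 16 ^ (n * (11 * K))"
      by (intro mult_le_mono1 card_grid_free_sets_coarse[OF assms(1)])
    also have "2 ^ (11 * K) * 2 ^ (m - 11 * K) = (2::nat) ^ m"
      using True by (simp flip: power_add)
    also have "2 * 16 ^ (2 ^ m) * 16 ^ (n * (11 * K)) \<le> (2 * 16 ^ (2 * n)) * (16::nat) ^ (n * (11 * K))"
      by (intro mult_le_mono1 mult_le_mono2 power_increasing assms(3)) auto
    also have "\<dots> = 2 * 16 ^ ((11 * K + 2) * n)"
      by (simp add: algebra_simps power_add)
    finally show ?thesis .
  next
    case False
    have "card (grid_free_sets K n 0) \<le> card (Pow ({..<1::nat} \<times> {..<1::nat}))"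
      by (intro card_mono) (auto simp: grid_free_sets_def)
    also have "\<dots> = 2" by (simp add: card_Pow)
    finally have "card (grid_free_sets K n 0) \<le> 2" .
    moreover have "n * m \<le> (11 * K + 2) * n" using False by (subst mult.commute) (rule mult_le_mono1, simp)
    ultimately have "card (grid_free_sets K n 0) * 16 ^ (n * m) \<le> 2 * 16 ^ ((11 * K + 2) * n)"
      by (intro mult_le_mono[OF _ power_increasing]) simp_all
    then show ?thesis
      using card_grid_free_sets_fine[OF assms(1), of n 0 m] by simp
  qed
  also have "(16::nat) = 2 ^ 4" by simp
  also have "2 * (2 ^ 4) ^ ((11 * K + 2) * n) = (2::nat) ^ Suc (4 * ((11 * K + 2) * n))"
    unfolding power_mult[symmetric] by simp
  \<comment> \<open>The exponent is \<open>44 * K * n + 8 * n + 1\<close>, at most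
    \<open>53 * K * n\<close> since \<open>K\<close> and \<open>n\<close> are positive; 56 rounds
    this up.\<close>
  also have "\<dots> \<le> 2 ^ (56 * K * n)"
  proof (intro power_increasing)
    have "n \<le> K * n" using assms(1) by simp
    moreover have "Suc (4 * ((11 * K + 2) * n)) = 44 * (K * n) + 8 * n + 1" "56 * K * n = 56 * (K * n)"
      by (simp_all add: algebra_simps)
    ultimately show "Suc (4 * ((11 * K + 2) * n)) \<le> 56 * K * n"
      using assms(2) by linarith
  qed simp
  finally show ?thesis .
qed

section \<open>Permutation patterns\<close>

text \<open>Matrices enter through their ones and permutations through their graphs, so one notion
  on point sets serves both.\<close>

definition has_pattern :: "nat \<Rightarrow> (nat \<Rightarrow> nat) \<Rightarrow> (nat \<times> nat) set \<Rightarrow> bool" where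
  "has_pattern k \<pi> E \<longleftrightarrow> (\<exists>x y :: nat \<Rightarrow> nat. strict_mono_on {1..k} x \<and> strict_mono_on {1..k} y \<and>
     (\<forall>i\<in>{1..k}. (x i, y (\<pi> i)) \<in> E))"

text \<open>For each \<open>i\<close>, take a one from the cell in row strip \<open>i\<close> and
  column strip \<open>\<pi> i\<close>. Points in distinct strips are ordered like the strips, so
  these ones form the pattern. Strips are numbered from 0 and \<open>\<pi>\<close> acts from 1,
  hence the shifts by one.\<close>

lemma has_pattern_of_has_grid:
  assumes \<pi>: "\<pi> permutes {1..k}" and g: "has_grid k k E"
  shows "has_pattern k \<pi> E"
proof -
  obtain r c where rc: "\<forall>i<k. \<forall>j<k.
    \<exists>x y. (x, y) \<in> E \<and> x \<in> {r i..<r (Suc i)} \<and> y \<in> {c j..<c (Suc j)}"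
    using g by (rule has_gridE) (rule that)
  have mono: "r i \<le> r j" "c i \<le> c j" if "i \<le> j" "j \<le> k" for i j
  proof -
    have *: "r m < r (Suc m)" "c m < c (Suc m)" if "m < k" for m
      using rc[rule_format, OF that that] by auto
    show "r i \<le> r j" "c i \<le> c j" using that
    proof (induction j rule: dec_induct)
      case (step m)
      { case 1 then show ?case using step.IH(1) *(1)[of m] by simp }
      { case 2 then show ?case using step.IH(2) *(2)[of m] by simp }
    qed auto
  qed
  have "\<forall>i\<in>{1..k}. \<exists>x y. (x, y) \<in> E \<and> x \<in> {r (i - 1)..<r i} \<and> y \<in> {c (\<pi> i - 1)..<c (\<pi> i)}"
  proof
    fix i assume i: "i \<in> {1..k}"
    then have "\<pi> i \<in> {1..k}" using permutes_in_image[OF \<pi>] by blast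
    with i have "i - 1 < k" "\<pi> i - 1 < k" "Suc (i - 1) = i" "Suc (\<pi> i - 1) = \<pi> i" by auto
    with rc[rule_format, of "i - 1" "\<pi> i - 1"]
    show "\<exists>x y. (x, y) \<in> E \<and> x \<in> {r (i - 1)..<r i} \<and> y \<in> {c (\<pi> i - 1)..<c (\<pi> i)}" by simp
  qed
  then obtain x y where xy: "\<And>i. i \<in> {1..k} \<Longrightarrow>
      (x i, y i) \<in> E \<and> x i \<in> {r (i - 1)..<r i} \<and> y i \<in> {c (\<pi> i - 1)..<c (\<pi> i)}"
    by metis
  \<comment> \<open>The chosen columns are indexed by rows; composing with the inverse of
    \<open>\<pi>\<close> lists them from left to right.\<close>
  define y' where "y' j = y (inv_into UNIV \<pi> j)" for j
  have inv: "inv_into UNIV \<pi> j \<in> {1..k}" "\<pi> (inv_into UNIV \<pi> j) = j" if "j \<in> {1..k}" for j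
    using that permutes_in_image[OF permutes_inv[OF \<pi>]] permutes_inverses[OF \<pi>] by auto
  show ?thesis
    unfolding has_pattern_def
  proof (intro exI conjI ballI)
    show "strict_mono_on {1..k} x"
    proof (rule strict_mono_onI)
      fix i j assume "i \<in> {1..k}" "j \<in> {1..k}" "i < j"
      then have "x i < r i" "r (j - 1) \<le> x j" "r i \<le> r (j - 1)"
        using xy[of i] xy[of j] mono(1)[of i "j - 1"] by auto
      then show "x i < x j" by simp
    qed
    show "strict_mono_on {1..k} y'"
    proof (rule strict_mono_onI)
      fix i j assume *: "i \<in> {1..k}" "j \<in> {1..k}" "i < j"
      then have "y' i < c i" "c (j - 1) \<le> y' j" "c i \<le> c (j - 1)"
        using xy[OF inv(1)[OF *(1)]] xy[OF inv(1)[OF *(2)]] inv(2) mono(2)[of i "j - 1"]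
        by (auto simp: y'_def)
      then show "y' i < y' j" by simp
    qed
    show "(x i, y' (\<pi> i)) \<in> E" if "i \<in> {1..k}" for i
      using xy[OF that] by (simp add: y'_def permutes_inverses[OF \<pi>])
  qed
qed

section \<open>Permutations and matrices as point sets\<close>

definition graph :: "nat \<Rightarrow> (nat \<Rightarrow> nat) \<Rightarrow> (nat \<times> nat) set" where
  "graph n \<sigma> = (\<lambda>i. (i, \<sigma> i)) ` {1..n}"

lemma card_graph [simp]: "card (graph n \<sigma>) = n"
  unfolding graph_def by (subst card_image) (auto intro: inj_onI)

lemma graph_subset: "\<sigma> permutes {1..n} \<Longrightarrow> graph n \<sigma> \<subseteq> {1..n} \<times> {1..n}"
  using permutes_in_image by (fastforce simp: graph_def)

lemma graph_inj:
  assumes "\<sigma> permutes {1..n}" "\<tau> permutes {1..n}" "graph n \<sigma> = graph n \<tau>"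
  shows "\<sigma> = \<tau>"
proof
  fix i
  show "\<sigma> i = \<tau> i"
  proof (cases "i \<in> {1..n}")
    case True
    then have "(i, \<sigma> i) \<in> graph n \<tau>" unfolding assms(3)[symmetric] by (simp add: graph_def)
    then show ?thesis by (auto simp: graph_def)
  qed (use assms(1,2) in \<open>simp add: permutes_not_in\<close>)
qed

lemma perm_contains_iff_has_pattern:
  assumes \<pi>: "\<pi> permutes {1..k}"
  shows "perm_contains n \<sigma> k \<pi> \<longleftrightarrow> has_pattern k \<pi> (graph n \<sigma>)"
proof
  assume "has_pattern k \<pi> (graph n \<sigma>)"
  then obtain x y where x: "strict_mono_on {1..k} x" and y: "strict_mono_on {1..k} y"
    and E: "\<forall>i\<in>{1..k}. (x i, y (\<pi> i)) \<in> graph n \<sigma>"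
    unfolding has_pattern_def by blast
  have *: "x i \<in> {1..n}" "\<sigma> (x i) = y (\<pi> i)" if "i \<in> {1..k}" for i
    using E[rule_format, OF that] by (auto simp: graph_def)
  show "perm_contains n \<sigma> k \<pi>"
    unfolding perm_contains_def
  proof (intro exI[of _ x] conjI ballI x)
    fix i j assume ij: "i \<in> {1..k}" "j \<in> {1..k}"
    show "\<sigma> (x i) < \<sigma> (x j) \<longleftrightarrow> \<pi> i < \<pi> j"
      using *(2)[OF ij(1)] *(2)[OF ij(2)] ij permutes_in_image[OF \<pi>] strict_mono_on_less[OF y, of "\<pi> i" "\<pi> j"] by simp
  qed (use *(1) in blast)
next
  assume "perm_contains n \<sigma> k \<pi>"
  then obtain x where x: "strict_mono_on {1..k} x" "x ` {1..k} \<subseteq> {1..n}"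
    and iff: "\<forall>i\<in>{1..k}. \<forall>j\<in>{1..k}. \<sigma> (x i) < \<sigma> (x j) \<longleftrightarrow> \<pi> i < \<pi> j"
    unfolding perm_contains_def by blast
  \<comment> \<open>Column \<open>j\<close> of the occurrence is the value of
    \<open>\<sigma>\<close> at the position that plays the value \<open>j\<close> of
    \<open>\<pi>\<close>; the order condition makes these values increase.\<close>
  have "strict_mono_on {1..k} (\<lambda>j. \<sigma> (x (inv_into UNIV \<pi> j)))"
  proof (rule strict_mono_onI)
    fix i j assume "i \<in> {1..k}" "j \<in> {1..k}" "i < j"
    then show "\<sigma> (x (inv_into UNIV \<pi> i)) < \<sigma> (x (inv_into UNIV \<pi> j))"
      using iff permutes_in_image[OF permutes_inv[OF \<pi>]] permutes_inverses[OF \<pi>] by simp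
  qed
  then show "has_pattern k \<pi> (graph n \<sigma>)"
    unfolding has_pattern_def using x
    by (intro exI[of _ x] exI[of _ "\<lambda>j. \<sigma> (x (inv_into UNIV \<pi> j))"])
      (auto simp: graph_def permutes_inverses[OF \<pi>])
qed

text \<open>Exactly \<open>i\<close> members of the image lie below \<open>x (Suc i)\<close>, and
  \<open>pick\<close> counts from 0. This links the index sets of \<open>submatrix\<close> to
  increasing sequences.\<close>

lemma pick_image_strict_mono:
  assumes x: "strict_mono_on {1..k} x" and "i < k"
  shows "pick (x ` {1..k}) i = x (Suc i)"
proof -
  have "{a \<in> x ` {1..k}. a < x (Suc i)} = x ` {1..i}"
    using strict_mono_on_less[OF x, of _ "Suc i"] assms(2) by auto
  moreover have "inj_on x {1..i}"
    using assms(2) by (intro inj_on_subset[OF strict_mono_on_imp_inj_on[OF x]]) auto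
  ultimately have "card {a \<in> x ` {1..k}. a < x (Suc i)} = i" by (simp add: card_image)
  then show ?thesis using pick_card_in_set[of "x (Suc i)" "x ` {1..k}"] assms(2) by simp
qed

definition ones :: "nat mat \<Rightarrow> (nat \<times> nat) set" where
  "ones A = {(i, j). i < dim_row A \<and> j < dim_col A \<and> A $$ (i, j) = 1}"

lemma mass_eq_card_ones: "mass A = card (ones A)"
  by (simp add: mass_def ones_def)

lemma ones_subset: "A \<in> carrier_mat n n \<Longrightarrow> ones A \<subseteq> {..<n} \<times> {..<n}"
  by (auto simp: ones_def)

lemma mat_contains_iff_has_pattern:
  assumes \<pi>: "\<pi> permutes {1..k}"
  shows "mat_contains A (permutation_mat k \<pi>) \<longleftrightarrow> has_pattern k \<pi> (ones A)"
proof
  assume "mat_contains A (permutation_mat k \<pi>)"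
  then obtain I J where I: "I \<subseteq> {..<dim_row A}" "card I = k"
    and J: "J \<subseteq> {..<dim_col A}" "card J = k"
    and one: "\<And>i j. i < k \<Longrightarrow> j < k \<Longrightarrow> \<pi> (Suc i) = Suc j \<Longrightarrow> submatrix A I J $$ (i, j) = 1"
    unfolding mat_contains_def permutation_mat_def by fastforce
  have eq: "{i. i < dim_row A \<and> i \<in> I} = I" "{j. j < dim_col A \<and> j \<in> J} = J"
    using I J by auto
  show "has_pattern k \<pi> (ones A)"
    unfolding has_pattern_def
  proof (intro exI conjI ballI)
    show "strict_mono_on {1..k} (\<lambda>i. pick I (i - 1))" "strict_mono_on {1..k} (\<lambda>j. pick J (j - 1))"
      using I(2) J(2) by (auto intro!: strict_mono_onI pick_mono)
    fix i assume i: "i \<in> {1..k}"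
    then have "\<pi> i \<in> {1..k}" using permutes_in_image[OF \<pi>] by blast
    with i have *: "i - 1 < k" "\<pi> i - 1 < k" "\<pi> (Suc (i - 1)) = Suc (\<pi> i - 1)" by auto
    have "A $$ (pick I (i - 1), pick J (\<pi> i - 1)) = 1"
      using one[OF *] * submatrix_index[of "i - 1" A I "\<pi> i - 1" J] I(2) J(2) by (simp add: eq)
    moreover have "pick I (i - 1) \<in> I" "pick J (\<pi> i - 1) \<in> J"
      using * I(2) J(2) by (auto intro: pick_in_set_le)
    ultimately show "(pick I (i - 1), pick J (\<pi> i - 1)) \<in> ones A"
      using I(1) J(1) by (auto simp: ones_def)
  qed
next
  assume "has_pattern k \<pi> (ones A)"
  then obtain x y where x: "strict_mono_on {1..k} x" and y: "strict_mono_on {1..k} y"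
    and E: "\<forall>i\<in>{1..k}. (x i, y (\<pi> i)) \<in> ones A"
    unfolding has_pattern_def by blast
  define I J where "I = x ` {1..k}" and "J = y ` {1..k}"
  have I: "I \<subseteq> {..<dim_row A}" "card I = k"
    using E strict_mono_on_imp_inj_on[OF x] by (auto simp: I_def ones_def card_image)
  have J: "J \<subseteq> {..<dim_col A}" "card J = k"
  proof -
    \<comment> \<open>Membership in \<open>ones A\<close> bounds the columns
      \<open>y (\<pi> i)\<close>; surjectivity of \<open>\<pi>\<close> makes these all of
      \<open>J\<close>.\<close>
    have "J = (\<lambda>i. y (\<pi> i)) ` {1..k}"
      unfolding J_def image_image[of y \<pi>, symmetric] permutes_image[OF \<pi>] ..
    then show "J \<subseteq> {..<dim_col A}" using E by (auto simp: ones_def)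
    show "card J = k" using strict_mono_on_imp_inj_on[OF y] by (simp add: J_def card_image)
  qed
  have eq: "{i. i < dim_row A \<and> i \<in> I} = I" "{j. j < dim_col A \<and> j \<in> J} = J"
    using I J by auto
  show "mat_contains A (permutation_mat k \<pi>)"
    unfolding mat_contains_def
  proof (rule exI[of _ I], rule exI[of _ J], intro conjI allI impI)
    fix i j
    assume "i < dim_row (permutation_mat k \<pi>)" "j < dim_col (permutation_mat k \<pi>)"
      and "permutation_mat k \<pi> $$ (i, j) = 1"
    then have ij: "i < k" "j < k" "\<pi> (Suc i) = Suc j"
      by (auto simp: permutation_mat_def split: if_splits)
    then have "submatrix A I J $$ (i, j) = A $$ (x (Suc i), y (Suc j))"
      using I(2) J(2) pick_image_strict_mono[OF x] pick_image_strict_mono[OF y]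
      by (subst submatrix_index) (simp_all add: eq, simp_all add: I_def J_def)
    also have "\<dots> = 1"
      using E[rule_format, of "Suc i"] ij by (simp add: ones_def)
    finally show "submatrix A I J $$ (i, j) = 1" .
  qed (use I J in \<open>auto simp: permutation_mat_def\<close>)
qed

section \<open>The extremal function and the two bounds for fixed n\<close>

lemma ex_mass_eq_Max:
  assumes \<pi>: "\<pi> permutes {1..k}"
  shows "ex_mass n k \<pi> = Max {card E | E. E \<subseteq> {..<n} \<times> {..<n} \<and> \<not> has_pattern k \<pi> E}"
proof -
  have "{mass A | A. A \<in> carrier_mat n n \<and> binary_mat A \<and> \<not> mat_contains A (permutation_mat k \<pi>)}
      = {card E | E. E \<subseteq> {..<n} \<times> {..<n} \<and> \<not> has_pattern k \<pi> E}" (is "?L = ?R")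
  proof
    show "?L \<subseteq> ?R"
      using ones_subset by (auto simp: mass_eq_card_ones mat_contains_iff_has_pattern[OF \<pi>])
    show "?R \<subseteq> ?L"
    proof clarify
      fix E assume E: "E \<subseteq> {..<n} \<times> {..<n}" "\<not> has_pattern k \<pi> E"
      define A :: "nat mat" where "A = mat n n (\<lambda>z. if z \<in> E then 1 else 0)"
      have "ones A = E" using E(1) by (auto simp: ones_def A_def split: if_splits)
      moreover have "A \<in> carrier_mat n n" "binary_mat A"
        by (auto simp: A_def binary_mat_def elements_mat_def)
      ultimately show "\<exists>A. card E = mass A \<and> A \<in> carrier_mat n n \<and> binary_mat A
          \<and> \<not> mat_contains A (permutation_mat k \<pi>)"
        using E(2) by (intro exI[of _ A]) (auto simp: mass_eq_card_ones mat_contains_iff_has_pattern[OF \<pi>])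
    qed
  qed
  then show ?thesis by (simp add: ex_mass_def)
qed

lemma finite_pattern_free:
  "finite {card E | E. E \<subseteq> {..<n} \<times> {..<n} \<and> \<not> has_pattern k \<pi> E}"
proof (rule finite_subset)
  show "{card E | E. E \<subseteq> {..<n} \<times> {..<n} \<and> \<not> has_pattern k \<pi> E} \<subseteq> card ` Pow ({..<n} \<times> {..<n})"
    by auto
qed simp

lemma card_le_ex_mass:
  assumes "\<pi> permutes {1..k}" "E \<subseteq> {..<n} \<times> {..<n}" "\<not> has_pattern k \<pi> E"
  shows "card E \<le> ex_mass n k \<pi>"
  unfolding ex_mass_eq_Max[OF assms(1)] using assms(2,3) by (intro Max_ge finite_pattern_free) auto

lemma ex_mass_attained:
  assumes "\<pi> permutes {1..k}" "k > 0"
  obtains E where "E \<subseteq> {..<n} \<times> {..<n}" "\<not> has_pattern k \<pi> E" "card E = ex_mass n k \<pi>"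
proof -
  \<comment> \<open>For \<open>k = 0\<close> every set would contain the pattern and the maximum
    would range over the empty set.\<close>
  have "\<not> has_pattern k \<pi> {}" using assms(2) by (auto simp: has_pattern_def)
  then have "{card E | E. E \<subseteq> {..<n} \<times> {..<n} \<and> \<not> has_pattern k \<pi> E} \<noteq> {}" by blast
  from Max_in[OF finite_pattern_free this]
  obtain E where "ex_mass n k \<pi> = card E" "E \<subseteq> {..<n} \<times> {..<n}" "\<not> has_pattern k \<pi> E"
    unfolding ex_mass_eq_Max[OF assms(1), symmetric] by blast
  then show thesis by (intro that) simp_all
qed

theorem ex_mass_le:
  assumes "\<pi> permutes {1..k}" "k > 0" "n > 0"
  shows "ex_mass n k \<pi> \<le> 2 ^ (11 * k) * n"
proof -
  obtain E where "E \<subseteq> {..<n} \<times> {..<n}" "\<not> has_pattern k \<pi> E" "card E = ex_mass n k \<pi>"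
    using ex_mass_attained[OF assms(1,2)] .
  then show ?thesis
    using card_grid_free[OF assms(2,3)] has_pattern_of_has_grid[OF assms(1)] by metis
qed

theorem avoiders_count_le:
  assumes \<pi>: "\<pi> permutes {1..k}" and "k > 0" "n > 0"
  shows "avoiders_count n k \<pi> \<le> 2 ^ (56 * k * n)"
proof -
  \<comment> \<open>\<open>2 ^ Suc m\<close> is the smallest power of two above \<open>n\<close>: a
    graph with coordinates in \<open>{1..n}\<close> fits without a shift, and the side is at most
    \<open>2 * n\<close>, as the counting bound requires.\<close>
  obtain m where m: "2 ^ m \<le> n" "n < 2 ^ Suc m"
    using ex_power_ivl1[of 2 n] assms(3) by auto
  have "avoiders_count n k \<pi> \<le> card (grid_free_sets k n (Suc m))"
    unfolding avoiders_count_def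
  proof (rule card_inj_on_le[OF _ _ finite_grid_free_sets])
    show "inj_on (graph n) {\<sigma>. \<sigma> permutes {1..n} \<and> \<not> perm_contains n \<sigma> k \<pi>}"
      using graph_inj by (intro inj_onI) blast
    show "graph n ` {\<sigma>. \<sigma> permutes {1..n} \<and> \<not> perm_contains n \<sigma> k \<pi>} \<subseteq> grid_free_sets k n (Suc m)"
    proof clarify
      fix \<sigma> assume \<sigma>: "\<sigma> permutes {1..n}" "\<not> perm_contains n \<sigma> k \<pi>"
      have "{1..n} \<subseteq> {..<2 ^ Suc m}" using m(2) by auto
      then have "graph n \<sigma> \<subseteq> {..<2 ^ Suc m} \<times> {..<2 ^ Suc m}"
        by (intro order_trans[OF graph_subset[OF \<sigma>(1)]] Sigma_mono)
      moreover have "\<not> has_grid k k (graph n \<sigma>)"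
        using \<sigma>(2) has_pattern_of_has_grid[OF \<pi>] perm_contains_iff_has_pattern[OF \<pi>] by blast
      ultimately show "graph n \<sigma> \<in> grid_free_sets k n (Suc m)" by (simp add: grid_free_sets_def)
    qed
  qed
  also have "\<dots> \<le> 2 ^ (56 * k * n)"
    using m(1) assms(2,3) by (intro card_grid_free_sets_sparse) auto
  finally show ?thesis .
qed

section \<open>Existence of the limits\<close>

text \<open>The limit is the supremum of the quotients. If the quotient at \<open>m\<close> is close
  to it, division of \<open>n\<close> by \<open>m\<close> with remainder shows that the quotients at
  all large \<open>n\<close> are almost as large.\<close>

lemma fekete_superadditive:
  fixes a :: "nat \<Rightarrow> real"
  assumes super: "\<And>m n. a m + a n \<le> a (m + n)" and nonneg: "\<And>n. 0 \<le> a n"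
    and bound: "\<And>n. n > 0 \<Longrightarrow> a n \<le> B * real n"
  shows "convergent (\<lambda>n. a n / real n)"
proof -
  define L where "L = (SUP n\<in>{0<..}. a n / real n)"
  have bdd: "bdd_above ((\<lambda>n. a n / real n) ` {0<..})"
    using bound by (intro bdd_aboveI[of _ B]) (auto simp: divide_le_eq)
  have mult: "real q * a m \<le> a (q * m)" for q m
  proof (induction q)
    case (Suc q)
    then show ?case using super[of "q * m" m] by (simp add: algebra_simps)
  qed (use nonneg in simp)
  have "(\<lambda>n. a n / real n) \<longlonglongrightarrow> L"
  proof (rule order_tendstoI)
    fix u assume "L < u"
    have "a n / real n < u" if "n > 0" for n
      using cSUP_upper[OF _ bdd, of n] that \<open>L < u\<close> unfolding L_def by auto
    then show "\<forall>\<^sub>F n in sequentially. a n / real n < u"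
      using eventually_gt_at_top[of 0] by (rule eventually_mono[rotated])
  next
    fix l assume "l < L"
    then obtain m where m: "m > 0" "l < a m / real m"
      using less_cSUP_iff[OF _ bdd] unfolding L_def by auto
    \<comment> \<open>Superadditivity gives \<open>a n\<close> at least
      \<open>(n div m) * a m\<close>, the remainder being dropped by nonnegativity, and
      \<open>n div m\<close> exceeds \<open>n / m - 1\<close>.\<close>
    have low: "a m / real m - a m / real n \<le> a n / real n" if "n > 0" for n
    proof -
      have "real n \<le> real m + real (n div m) * real m"
        using dividend_less_times_div[OF m(1), of n]
        by (simp add: mult.commute flip: of_nat_mult of_nat_add)
      then have "real n * a m \<le> (real m + real (n div m) * real m) * a m"
        by (intro mult_right_mono nonneg)
      then have "(a m / real m) * real n - a m \<le> real (n div m) * a m"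
        using m(1) by (simp add: field_simps)
      also have "\<dots> \<le> a (n div m * m)" by (rule mult)
      also have "\<dots> \<le> a n" using super[of "n div m * m" "n mod m"] nonneg[of "n mod m"] by simp
      finally have "((a m / real m) * real n - a m) / real n \<le> a n / real n"
        by (rule divide_right_mono) simp
      then show ?thesis using that by (simp add: diff_divide_distrib)
    qed
    have "(\<lambda>n. a m / real m - a m / real n) \<longlonglongrightarrow> a m / real m - 0"
      by (intro tendsto_diff tendsto_const lim_const_over_n)
    then have "\<forall>\<^sub>F n in sequentially. l < a m / real m - a m / real n"
      using m(2) by (intro order_tendstoD(1)) auto
    with eventually_gt_at_top[of 0] show "\<forall>\<^sub>F n in sequentially. l < a n / real n"
    proof eventually_elim
      case (elim n)
      show ?case using elim(2) low[OF elim(1)] by linarith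
    qed
  qed
  then show ?thesis by (rule convergentI)
qed

section \<open>Direct and skew sums\<close>

lemma initial_segment_eq:
  fixes S :: "nat set"
  assumes "S \<subseteq> {1..k}" and down: "\<And>i j. i \<in> S \<Longrightarrow> 1 \<le> j \<Longrightarrow> j \<le> i \<Longrightarrow> j \<in> S"
  shows "S = {1..card S}"
proof (cases "S = {}")
  case False
  have fin: "finite S" using assms(1) finite_subset by blast
  have "S = {1..Max S}"
  proof
    show "S \<subseteq> {1..Max S}" using assms(1) Max_ge[OF fin] by auto
    show "{1..Max S} \<subseteq> S" using down[OF Max_in[OF fin False]] by auto
  qed
  then show ?thesis by (metis card_atLeastAtMost diff_Suc_1)
qed simp

definition shift :: "nat \<Rightarrow> nat \<Rightarrow> (nat \<times> nat) set \<Rightarrow> (nat \<times> nat) set" where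
  "shift a b E = (\<lambda>(x, y). (x + a, y + b)) ` E"

lemma card_shift [simp]: "card (shift a b E) = card E"
  unfolding shift_def by (rule card_image) (auto simp: inj_on_def)

lemma has_pattern_of_has_pattern_shift:
  assumes \<pi>: "\<pi> permutes {1..k}" and p: "has_pattern k \<pi> (shift a b E)"
  shows "has_pattern k \<pi> E"
proof -
  obtain x y where x: "strict_mono_on {1..k} x" and y: "strict_mono_on {1..k} y"
    and E: "\<forall>i\<in>{1..k}. (x i, y (\<pi> i)) \<in> shift a b E"
    using p unfolding has_pattern_def by blast
  have *: "a \<le> x i" "b \<le> y (\<pi> i)" "(x i - a, y (\<pi> i) - b) \<in> E" if "i \<in> {1..k}" for i
    using E[rule_format, OF that] by (auto simp: shift_def)
  \<comment> \<open>Surjectivity of \<open>\<pi>\<close> extends the lower bound to all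
    \<open>y j\<close>, so the truncated subtraction below stays strictly increasing.\<close>
  have b: "b \<le> y j" if "j \<in> {1..k}" for j
    using that *(2) permutes_image[OF \<pi>] by (metis imageE)
  show ?thesis
    unfolding has_pattern_def
  proof (intro exI conjI ballI)
    show "strict_mono_on {1..k} (\<lambda>i. x i - a)"
      using strict_mono_onD[OF x] *(1) by (intro strict_mono_onI diff_less_mono) auto
    show "strict_mono_on {1..k} (\<lambda>j. y j - b)"
      using strict_mono_onD[OF y] b by (intro strict_mono_onI diff_less_mono) auto
  qed (use *(3) in auto)
qed

text \<open>The direct sum for \<open>s = True\<close> and the skew sum for \<open>s = False\<close>.\<close>

definition join :: "bool \<Rightarrow> nat \<Rightarrow> nat \<Rightarrow> (nat \<times> nat) set \<Rightarrow> (nat \<times> nat) set \<Rightarrow> (nat \<times> nat) set" where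
  "join s m n E F = (if s then E \<union> shift m m F else shift 0 n E \<union> shift m 0 F)"

text \<open>The complement for \<open>s = False\<close> is \<open>{k - p + 1..k}\<close>; it is
  written as it arises below, by complementing an initial segment of values.\<close>

definition decomposable :: "bool \<Rightarrow> nat \<Rightarrow> (nat \<Rightarrow> nat) \<Rightarrow> bool" where
  "decomposable s k \<pi> \<longleftrightarrow>
     (\<exists>p. 0 < p \<and> p < k \<and> \<pi> ` {1..p} = (if s then {1..p} else {1..k} - {1..k - p}))"

text \<open>Compare the two prefixes. If \<open>p \<le> q\<close>, the value 1 occurs among the
  first \<open>q\<close> positions, which carry only the \<open>q < k\<close> largest values.
  Otherwise the value \<open>k\<close> occurs among the first \<open>p\<close> positions, which
  carry only values up to \<open>p < k\<close>.\<close>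

lemma not_both_decomposable: "\<not> (decomposable True k \<pi> \<and> decomposable False k \<pi>)"
proof
  assume "decomposable True k \<pi> \<and> decomposable False k \<pi>"
  then obtain p q where p: "0 < p" "p < k" "\<pi> ` {1..p} = {1..p}"
    and q: "0 < q" "q < k" "\<pi> ` {1..q} = {1..k} - {1..k - q}"
    unfolding decomposable_def by auto
  show False
  proof (cases "p \<le> q")
    case True
    then have "\<pi> ` {1..p} \<subseteq> \<pi> ` {1..q}" by (intro image_mono) auto
    moreover have "1 \<in> \<pi> ` {1..p}" unfolding p(3) using p(1) by simp
    ultimately have "1 \<in> {1..k} - {1..k - q}" using q(3) by blast
    with q show False by auto
  next
    case False
    then have "\<pi> ` {1..q} \<subseteq> \<pi> ` {1..p}" by (intro image_mono) auto
    moreover have "k \<in> \<pi> ` {1..q}" unfolding q(3) using q(1,2) by simp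
    ultimately have "k \<in> {1..p}" using p(3) by blast
    with p show False by auto
  qed
qed

text \<open>The positions of an occurrence that fall into the copy of \<open>E\<close> form an
  initial segment \<open>S\<close>. If \<open>S\<close> were neither empty nor everything, it would
  decompose \<open>\<pi>\<close>; so the occurrence lies in one summand. The offset \<open>l\<close>
  covers indexing both from 0 (matrices) and from 1 (permutations).\<close>

lemma has_pattern_of_has_pattern_join:
  assumes \<pi>: "\<pi> permutes {1..k}" and ind: "\<not> decomposable s k \<pi>"
    and E: "E \<subseteq> {l..<l + m} \<times> {l..<l + m}" and F: "F \<subseteq> {l..<l + n} \<times> {l..<l + n}"
    and p: "has_pattern k \<pi> (join s m n E F)"
  shows "has_pattern k \<pi> E \<or> has_pattern k \<pi> F"
proof -
  define E' where "E' = (if s then E else shift 0 n E)"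
  define F' where "F' = (if s then shift m m F else shift m 0 F)"
  obtain x y where x: "strict_mono_on {1..k} x" and y: "strict_mono_on {1..k} y"
    and xy: "\<forall>i\<in>{1..k}. (x i, y (\<pi> i)) \<in> E' \<union> F'"
    using p unfolding has_pattern_def join_def E'_def F'_def by (auto split: if_splits)
  define S where "S = {i \<in> {1..k}. x i < l + m}"
  \<comment> \<open>The lower column band belongs to the copy of \<open>E\<close> in a direct sum
    and has width \<open>m\<close>; in a skew sum it belongs to the copy of \<open>F\<close> and has
    width \<open>n\<close>.\<close>
  define T where "T = {j \<in> {1..k}. y j < l + (if s then m else n)}"
  have S_eq: "S = {1..card S}"
  proof (rule initial_segment_eq)
    show "j \<in> S" if "i \<in> S" "1 \<le> j" "j \<le> i" for i j
      using that strict_mono_on_leD[OF x, of j i] by (auto simp: S_def)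
  qed (auto simp: S_def)
  have T_eq: "T = {1..card T}"
  proof (rule initial_segment_eq)
    show "j \<in> T" if "i \<in> T" "1 \<le> j" "j \<le> i" for i j
      using that strict_mono_on_leD[OF y, of j i] by (auto simp: T_def)
  qed (auto simp: T_def)
  have boxE: "l \<le> a \<and> a < l + m \<and> l \<le> b \<and> b < l + m" if "(a, b) \<in> E" for a b
    using that E by auto
  have boxF: "l \<le> a \<and> a < l + n \<and> l \<le> b \<and> b < l + n" if "(a, b) \<in> F" for a b
    using that F by auto
  have E': "a < l + m \<and> (if s then b < l + m else l + n \<le> b)" if "(a, b) \<in> E'" for a b
    using that by (auto simp: E'_def shift_def split: if_splits dest!: boxE)
  have F': "l + m \<le> a \<and> (if s then l + m \<le> b else b < l + n)" if "(a, b) \<in> F'" for a b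
    using that by (auto simp: F'_def shift_def split: if_splits dest!: boxF)
  have memE: "(x i, y (\<pi> i)) \<in> E'" if "i \<in> S" for i
    using that bspec[OF xy, of i] F'[of "x i" "y (\<pi> i)"] by (auto simp: S_def)
  have memF: "(x i, y (\<pi> i)) \<in> F'" if "i \<in> {1..k} - S" for i
    using that bspec[OF xy, of i] E'[of "x i" "y (\<pi> i)"] by (auto simp: S_def)
  have T_iff: "\<pi> i \<in> T \<longleftrightarrow> (i \<in> S \<longleftrightarrow> s)" if "i \<in> {1..k}" for i
  proof -
    have "\<pi> i \<in> {1..k}" using that permutes_in_image[OF \<pi>] by blast
    then have "\<pi> i \<in> T \<longleftrightarrow> y (\<pi> i) < l + (if s then m else n)" by (simp add: T_def)
    also have "\<dots> \<longleftrightarrow> (i \<in> S \<longleftrightarrow> s)"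
    proof (cases "i \<in> S")
      case True
      with E'[OF memE[OF this]] show ?thesis by (auto split: if_splits)
    next
      case False
      with that have "i \<in> {1..k} - S" by simp
      with False F'[OF memF[OF this]] show ?thesis by (auto split: if_splits)
    qed
    finally show ?thesis .
  qed
  have sub: "S \<subseteq> {1..k}" "T \<subseteq> {1..k}" by (auto simp: S_def T_def)
  have fin: "finite S" "finite T" using sub finite_subset by blast+
  have cardS: "card S \<le> k" using card_mono[OF _ sub(1)] by simp
  have inj: "inj_on \<pi> A" for A using permutes_inj[OF \<pi>] inj_on_subset by blast
  have im: "\<pi> ` S = (if s then {1..card S} else {1..k} - {1..k - card S})"
  proof (cases s)
    case True
    have "\<pi> ` S = T"
    proof
      show "\<pi> ` S \<subseteq> T" using T_iff sub True by auto
      show "T \<subseteq> \<pi> ` S"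
      proof
        fix j assume "j \<in> T"
        then have "j \<in> \<pi> ` {1..k}" using sub permutes_image[OF \<pi>] by auto
        with \<open>j \<in> T\<close> show "j \<in> \<pi> ` S" using T_iff True by auto
      qed
    qed
    moreover from this have "card T = card S" using inj card_image by metis
    ultimately show ?thesis using T_eq True by simp
  next
    case False
    \<comment> \<open>In a skew sum the low values belong to the positions outside \<open>S\<close>,
      so the image of \<open>S\<close> is found by complementing.\<close>
    have "\<pi> ` ({1..k} - S) = T"
    proof
      show "\<pi> ` ({1..k} - S) \<subseteq> T" using T_iff False by auto
      show "T \<subseteq> \<pi> ` ({1..k} - S)"
      proof
        fix j assume "j \<in> T"
        then have "j \<in> \<pi> ` {1..k}" using sub permutes_image[OF \<pi>] by auto
        with \<open>j \<in> T\<close> show "j \<in> \<pi> ` ({1..k} - S)" using T_iff False by auto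
      qed
    qed
    moreover from this have "card T = k - card S"
      using card_image[OF inj, of "{1..k} - S"] card_Diff_subset[OF fin(1) sub(1)] by simp
    moreover have "\<pi> ` ({1..k} - S) = {1..k} - \<pi> ` S"
      by (simp only: image_set_diff[OF permutes_inj[OF \<pi>]] permutes_image[OF \<pi>])
    moreover have "\<pi> ` S \<subseteq> {1..k}" using sub permutes_image[OF \<pi>] by blast
    ultimately have "\<pi> ` S = {1..k} - {1..k - card S}" using T_eq by (metis double_diff order_refl)
    then show ?thesis using False by simp
  qed
  then have "\<not> (0 < card S \<and> card S < k)"
    using ind S_eq unfolding decomposable_def by metis
  then consider "card S = 0" | "card S = k" using cardS by linarith
  then show ?thesis
  proof cases
    case 1
    then have "S = {}" using fin by simp
    then have "has_pattern k \<pi> F'" using x y memF unfolding has_pattern_def by blast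
    then show ?thesis using has_pattern_of_has_pattern_shift[OF \<pi>] unfolding F'_def by (metis (full_types))
  next
    case 2
    then have "S = {1..k}" using S_eq by simp
    then have "has_pattern k \<pi> E'" using x y memE unfolding has_pattern_def by blast
    then show ?thesis using has_pattern_of_has_pattern_shift[OF \<pi>] unfolding E'_def by (metis (full_types))
  qed
qed

lemma join_subset:
  assumes "E \<subseteq> {l..<l + m} \<times> {l..<l + m}" "F \<subseteq> {l..<l + n} \<times> {l..<l + n}"
  shows "join s m n E F \<subseteq> {l..<l + (m + n)} \<times> {l..<l + (m + n)}"
proof -
  have shift: "shift a b G \<subseteq> {l..<l + (m + n)} \<times> {l..<l + (m + n)}"
    if "G \<subseteq> {l..<l + u} \<times> {l..<l + u}" "u + a \<le> m + n" "u + b \<le> m + n" for G u a b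
    unfolding shift_def
  proof (rule image_subsetI)
    fix z assume "z \<in> G"
    with that(1) have "z \<in> {l..<l + u} \<times> {l..<l + u}" by blast
    with that(2,3) show "(\<lambda>(x, y). (x + a, y + b)) z \<in> {l..<l + (m + n)} \<times> {l..<l + (m + n)}"
      by (cases z) auto
  qed
  have "E \<subseteq> {l..<l + (m + n)} \<times> {l..<l + (m + n)}"
    by (rule order_trans[OF assms(1)]) auto
  then show ?thesis
    using shift[OF assms(1), of 0 n] shift[OF assms(2), of m m] shift[OF assms(2), of m 0]
    by (simp add: join_def)
qed

lemma card_join:
  assumes "E \<subseteq> {l..<l + m} \<times> {l..<l + m}" "F \<subseteq> {l..<l + n} \<times> {l..<l + n}"
  shows "card (join s m n E F) = card E + card F"
proof -
  have "finite E" "finite F" using assms finite_subset by blast+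
  then have "finite (shift a b E)" "finite (shift a b F)" for a b by (auto simp: shift_def)
  moreover have "E \<inter> shift m m F = {}" "shift 0 n E \<inter> shift m 0 F = {}"
  proof -
    have "fst z < l + m" if "z \<in> E" for z using that assms(1) by auto
    moreover have "l \<le> fst z" if "z \<in> F" for z using that assms(2) by auto
    ultimately show "E \<inter> shift m m F = {}" "shift 0 n E \<inter> shift m 0 F = {}"
      by (fastforce simp: shift_def)+
  qed
  ultimately show ?thesis
    using \<open>finite E\<close> by (simp add: join_def card_Un_disjoint)
qed

section \<open>Superadditivity and convergence for the extremal function\<close>

lemma ex_mass_superadditive:
  assumes \<pi>: "\<pi> permutes {1..k}" and "k > 0"
  shows "ex_mass m k \<pi> + ex_mass n k \<pi> \<le> ex_mass (m + n) k \<pi>"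
proof -
  obtain s where s: "\<not> decomposable s k \<pi>" using not_both_decomposable by blast
  obtain E where E: "E \<subseteq> {..<m} \<times> {..<m}" "\<not> has_pattern k \<pi> E" "card E = ex_mass m k \<pi>"
    using ex_mass_attained[OF assms] .
  obtain F where F: "F \<subseteq> {..<n} \<times> {..<n}" "\<not> has_pattern k \<pi> F" "card F = ex_mass n k \<pi>"
    using ex_mass_attained[OF assms] .
  have EF: "E \<subseteq> {0..<0 + m} \<times> {0..<0 + m}" "F \<subseteq> {0..<0 + n} \<times> {0..<0 + n}"
    using E(1) F(1) by (auto simp: lessThan_atLeast0)
  have "card (join s m n E F) \<le> ex_mass (m + n) k \<pi>"
    using has_pattern_of_has_pattern_join[OF \<pi> s EF] E(2) F(2) join_subset[OF EF]
    by (intro card_le_ex_mass[OF \<pi>]) (auto simp: lessThan_atLeast0)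
  then show ?thesis using card_join[OF EF] E(3) F(3) by simp
qed

theorem convergent_ex_mass:
  assumes "\<pi> permutes {1..k}" "k > 0"
  shows "convergent (\<lambda>n. real (ex_mass n k \<pi>) / real n)"
proof (rule fekete_superadditive)
  show "real (ex_mass m k \<pi>) + real (ex_mass n k \<pi>) \<le> real (ex_mass (m + n) k \<pi>)" for m n
    using ex_mass_superadditive[OF assms] by (simp flip: of_nat_add)
  show "real (ex_mass n k \<pi>) \<le> 2 ^ (11 * k) * real n" if "n > 0" for n
  proof -
    have "real (ex_mass n k \<pi>) \<le> real (2 ^ (11 * k) * n)"
      using ex_mass_le[OF assms that] by (simp only: of_nat_le_iff)
    then show ?thesis by simp
  qed
qed simp

section \<open>Supermultiplicativity and convergence for the avoider count\<close>

definition perm_join :: "bool \<Rightarrow> nat \<Rightarrow> nat \<Rightarrow> (nat \<Rightarrow> nat) \<Rightarrow> (nat \<Rightarrow> nat) \<Rightarrow> nat \<Rightarrow> nat" where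
  "perm_join s m n \<sigma> \<tau> i =
     (if i \<in> {1..m} then \<sigma> i + (if s then 0 else n)
      else if i \<in> {m + 1..m + n} then \<tau> (i - m) + (if s then m else 0) else i)"

lemma graph_perm_join:
  "graph (m + n) (perm_join s m n \<sigma> \<tau>) = join s m n (graph m \<sigma>) (graph n \<tau>)"
proof -
  have "{1..m + n} = {1..m} \<union> (\<lambda>i. i + m) ` {1..n}"
    unfolding image_add_atLeastAtMost' by auto
  then have "graph (m + n) (perm_join s m n \<sigma> \<tau>)
      = (\<lambda>i. (i, perm_join s m n \<sigma> \<tau> i)) ` {1..m} \<union> (\<lambda>i. (i + m, perm_join s m n \<sigma> \<tau> (i + m))) ` {1..n}"
    by (simp only: graph_def image_Un image_image)
  also have "(\<lambda>i. (i, perm_join s m n \<sigma> \<tau> i)) ` {1..m} = shift 0 (if s then 0 else n) (graph m \<sigma>)"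
    unfolding graph_def shift_def image_image by (intro image_cong) (auto simp: perm_join_def)
  also have "(\<lambda>i. (i + m, perm_join s m n \<sigma> \<tau> (i + m))) ` {1..n} = shift m (if s then m else 0) (graph n \<tau>)"
    unfolding graph_def shift_def image_image by (intro image_cong) (auto simp: perm_join_def)
  finally show ?thesis by (auto simp: join_def shift_def)
qed

text \<open>An injective map of a finite set into itself is onto, so injectivity and the range
  suffice. The default value \<open>i\<close> in \<open>perm_join\<close> fixes everything outside
  \<open>{1..m + n}\<close>.\<close>

lemma perm_join_permutes:
  assumes "\<sigma> permutes {1..m}" "\<tau> permutes {1..n}"
  shows "perm_join s m n \<sigma> \<tau> permutes {1..m + n}"
proof (rule bij_imp_permutes)
  have \<sigma>: "\<sigma> i \<in> {1..m}" if "i \<in> {1..m}" for i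
    using that permutes_in_image[OF assms(1)] by blast
  have \<tau>: "\<tau> i \<in> {1..n}" if "i \<in> {1..n}" for i
    using that permutes_in_image[OF assms(2)] by blast
  have "inj_on (perm_join s m n \<sigma> \<tau>) {1..m + n}"
  proof (rule inj_onI)
    fix i j assume ij: "i \<in> {1..m + n}" "j \<in> {1..m + n}"
      and eq: "perm_join s m n \<sigma> \<tau> i = perm_join s m n \<sigma> \<tau> j"
    have cases: "i \<in> {1..m} \<or> i - m \<in> {1..n} \<and> m < i" "j \<in> {1..m} \<or> j - m \<in> {1..n} \<and> m < j"
      using ij by auto
    have inj: "\<sigma> u = \<sigma> v \<longleftrightarrow> u = v" "\<tau> u = \<tau> v \<longleftrightarrow> u = v" for u v
      using permutes_inj[OF assms(1)] permutes_inj[OF assms(2)] by (auto simp: inj_eq)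
    show "i = j"
      using cases eq \<sigma>[of i] \<sigma>[of j] \<tau>[of "i - m"] \<tau>[of "j - m"]
      by (auto simp: perm_join_def inj split: if_splits)
  qed
  moreover have "perm_join s m n \<sigma> \<tau> i \<in> {1..m + n}" if "i \<in> {1..m + n}" for i
  proof (cases "i \<le> m")
    case True
    then show ?thesis using that \<sigma>[of i] by (auto simp: perm_join_def)
  next
    case False
    then have "i - m \<in> {1..n}" using that by auto
    from \<tau>[OF this] show ?thesis using that False by (auto simp: perm_join_def)
  qed
  then have "perm_join s m n \<sigma> \<tau> ` {1..m + n} \<subseteq> {1..m + n}" by blast
  ultimately show "bij_betw (perm_join s m n \<sigma> \<tau>) {1..m + n} {1..m + n}"
    by (simp add: bij_betw_def endo_inj_surj)
qed (auto simp: perm_join_def)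

lemma perm_join_eqD:
  assumes perms: "\<sigma> permutes {1..m}" "\<sigma>' permutes {1..m}" "\<tau> permutes {1..n}" "\<tau>' permutes {1..n}"
    and eq: "perm_join s m n \<sigma> \<tau> = perm_join s m n \<sigma>' \<tau>'"
  shows "\<sigma> = \<sigma>'" "\<tau> = \<tau>'"
proof -
  show "\<sigma> = \<sigma>'"
  proof
    fix i show "\<sigma> i = \<sigma>' i"
      using fun_cong[OF eq, of i] perms(1,2)
      by (cases "i \<in> {1..m}") (auto simp: perm_join_def permutes_not_in)
  qed
  show "\<tau> = \<tau>'"
  proof
    fix i show "\<tau> i = \<tau>' i"
      using fun_cong[OF eq, of "i + m"] perms(3,4)
      by (cases "i \<in> {1..n}") (auto simp: perm_join_def permutes_not_in)
  qed
qed

lemma finite_avoiders: "finite {\<sigma>. \<sigma> permutes {1..n} \<and> \<not> perm_contains n \<sigma> k \<pi>}"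
  by (rule finite_subset[OF _ finite_permutations[of "{1..n}"]]) auto

text \<open>With the kind of sum for which \<open>\<pi>\<close> is indecomposable, joining two
  avoiders gives an avoider, from which both parts can be recovered.\<close>

lemma avoiders_count_supermultiplicative:
  assumes \<pi>: "\<pi> permutes {1..k}"
  shows "avoiders_count m k \<pi> * avoiders_count n k \<pi> \<le> avoiders_count (m + n) k \<pi>"
proof -
  obtain s where s: "\<not> decomposable s k \<pi>" using not_both_decomposable by blast
  define A where "A n = {\<sigma>. \<sigma> permutes {1..n} \<and> \<not> perm_contains n \<sigma> k \<pi>}" for n
  have fin: "finite (A n)" for n unfolding A_def by (rule finite_avoiders)
  have "card (A m \<times> A n) \<le> card (A (m + n))"
  proof (rule card_inj_on_le[OF _ _ fin])
    show "inj_on (\<lambda>(\<sigma>, \<tau>). perm_join s m n \<sigma> \<tau>) (A m \<times> A n)"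
    proof (rule inj_onI, clarify)
      fix \<sigma> \<tau> \<sigma>' \<tau>'
      assume "\<sigma> \<in> A m" "\<tau> \<in> A n" "\<sigma>' \<in> A m" "\<tau>' \<in> A n"
        and eq: "perm_join s m n \<sigma> \<tau> = perm_join s m n \<sigma>' \<tau>'"
      then have "\<sigma> permutes {1..m}" "\<sigma>' permutes {1..m}" "\<tau> permutes {1..n}" "\<tau>' permutes {1..n}"
        by (auto simp: A_def)
      from perm_join_eqD[OF this eq] show "\<sigma> = \<sigma>' \<and> \<tau> = \<tau>'" ..
    qed
    show "(\<lambda>(\<sigma>, \<tau>). perm_join s m n \<sigma> \<tau>) ` (A m \<times> A n) \<subseteq> A (m + n)"
    proof clarify
      fix \<sigma> \<tau> assume *: "\<sigma> \<in> A m" "\<tau> \<in> A n"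
      have sub: "graph n \<rho> \<subseteq> {1..<1 + n} \<times> {1..<1 + n}" if "\<rho> permutes {1..n}" for n \<rho>
        using graph_subset[OF that] by fastforce
      have "\<not> has_pattern k \<pi> (join s m n (graph m \<sigma>) (graph n \<tau>))"
        using has_pattern_of_has_pattern_join[OF \<pi> s sub sub] * perm_contains_iff_has_pattern[OF \<pi>]
        by (auto simp: A_def)
      then show "perm_join s m n \<sigma> \<tau> \<in> A (m + n)"
        using * perm_join_permutes
        by (auto simp: A_def perm_contains_iff_has_pattern[OF \<pi>] graph_perm_join)
    qed
  qed
  then show ?thesis by (simp add: avoiders_count_def A_def card_cartesian_product)
qed

text \<open>This makes the logarithm of the count meaningful. The permutation of one point avoids
  \<open>\<pi>\<close> because \<open>k \<ge> 2\<close>, and supermultiplicativity adds one point at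
  a time.\<close>

lemma avoiders_count_pos:
  assumes \<pi>: "\<pi> permutes {1..k}" and "k \<ge> 2"
  shows "avoiders_count n k \<pi> > 0"
proof (induction n)
  case 0
  have "id \<in> {\<sigma>. \<sigma> permutes {1..0::nat} \<and> \<not> perm_contains 0 \<sigma> k \<pi>}"
    using assms(2) by (auto simp: perm_contains_def permutes_id)
  then show ?case using finite_avoiders unfolding avoiders_count_def by (subst card_gt_0_iff) blast
next
  case (Suc n)
  have "\<not> perm_contains 1 id k \<pi>"
  proof
    assume "perm_contains 1 id k \<pi>"
    then obtain x where x: "strict_mono_on {1..k} x" "x ` {1..k} \<subseteq> {1..1::nat}"
      unfolding perm_contains_def by blast
    have "x 1 < x 2" using strict_mono_onD[OF x(1), of 1 2] assms(2) by simp
    moreover have "x i = 1" if "i \<in> {1..k}" for i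
      using that x(2) by (meson antisym atLeastAtMost_iff imageI subsetD)
    ultimately show False using assms(2) by simp
  qed
  then have "id \<in> {\<sigma>. \<sigma> permutes {1..1::nat} \<and> \<not> perm_contains 1 \<sigma> k \<pi>}"
    using permutes_id by blast
  then have "avoiders_count 1 k \<pi> > 0"
    using finite_avoiders unfolding avoiders_count_def by (subst card_gt_0_iff) blast
  then have "0 < avoiders_count n k \<pi> * avoiders_count 1 k \<pi>" using Suc by simp
  also have "\<dots> \<le> avoiders_count (Suc n) k \<pi>"
    using avoiders_count_supermultiplicative[OF \<pi>, of n 1] by simp
  finally show ?case .
qed

lemma avoiders_count_1:
  assumes "n > 0"
  shows "avoiders_count n 1 \<pi> = 0"
proof -
  have "perm_contains n \<sigma> 1 \<pi>" for \<sigma>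
    unfolding perm_contains_def using assms by (intro exI[of _ "\<lambda>_. 1"]) (auto intro: strict_mono_onI)
  then show ?thesis by (simp add: avoiders_count_def)
qed

theorem convergent_avoiders_count:
  assumes \<pi>: "\<pi> permutes {1..k}" and "k > 0"
  shows "convergent (\<lambda>n. root n (real (avoiders_count n k \<pi>)))"
proof (cases "k = 1")
  case True
  have "\<forall>\<^sub>F n in sequentially. root n (real (avoiders_count n k \<pi>)) = 0"
    using eventually_gt_at_top[of 0] by eventually_elim (simp add: True avoiders_count_1 del: One_nat_def)
  then show ?thesis by (rule convergentI[OF tendsto_eventually])
next
  case False
  then have "k \<ge> 2" using assms(2) by simp
  \<comment> \<open>The logarithm turns supermultiplicativity into superadditivity; for positive
    \<open>n\<close>, \<open>a n / n\<close> is the logarithm of the \<open>n\<close>-th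
    root.\<close>
  define a where "a n = ln (real (avoiders_count n k \<pi>))" for n
  note pos = avoiders_count_pos[OF \<pi> \<open>k \<ge> 2\<close>]
  have "convergent (\<lambda>n. a n / real n)"
  proof (rule fekete_superadditive)
    fix m n
    have "a m + a n = ln (real (avoiders_count m k \<pi> * avoiders_count n k \<pi>))"
      using pos by (simp add: a_def ln_mult)
    also have "\<dots> \<le> a (m + n)"
      unfolding a_def using pos avoiders_count_supermultiplicative[OF \<pi>]
      by (subst ln_le_cancel_iff) (simp_all flip: of_nat_mult)
    finally show "a m + a n \<le> a (m + n)" .
  next
    fix n show "0 \<le> a n" using pos[of n] by (simp add: a_def)
  next
    fix n :: nat assume "n > 0"
    have "real (avoiders_count n k \<pi>) \<le> real (2 ^ (56 * k * n))"
      using avoiders_count_le[OF assms \<open>n > 0\<close>] by (simp only: of_nat_le_iff)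
    then have "a n \<le> ln (2 ^ (56 * k * n))"
      unfolding a_def using pos[of n] by (subst ln_le_cancel_iff) simp_all
    then show "a n \<le> (56 * real k * ln 2) * real n" by (simp add: ln_realpow mult_ac)
  qed
  then obtain L where "(\<lambda>n. a n / real n) \<longlonglongrightarrow> L" by (auto simp: convergent_def)
  then have "(\<lambda>n. exp (a n / real n)) \<longlonglongrightarrow> exp L" by (rule tendsto_exp)
  moreover have "\<forall>\<^sub>F n in sequentially. exp (a n / real n) = root n (real (avoiders_count n k \<pi>))"
    using eventually_gt_at_top[of 0]
  proof eventually_elim
    case (elim n)
    then show ?case
      using pos[of n] by (simp add: a_def root_powr_inverse powr_def divide_inverse mult.commute)
  qed
  ultimately show ?thesis using tendsto_cong convergentI by metis
qed

theorem theorem3: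
  shows "\<exists>C::real. C > 0 \<and>
    (\<forall>k::nat. k \<ge> 1 \<longrightarrow> (\<forall>\<pi> :: nat \<Rightarrow> nat. \<pi> permutes {1..k} \<longrightarrow>
       furedi_hajnal_limit k \<pi> \<le> 2 powr (C * real k) \<and>
       stanley_wilf_limit k \<pi> \<le> 2 powr (C * real k)))"
\<comment> \<open>56 is the constant from the avoider count; it also exceeds the 11 of the mass
  bound.\<close>
proof (intro exI[of _ 56] conjI allI impI)
  fix k :: nat and \<pi> :: "nat \<Rightarrow> nat"
  assume k: "k \<ge> 1" and \<pi>: "\<pi> permutes {1..k}"
  then have "k > 0" by simp
  have powr: "2 powr (56 * real k) = (2 ^ (56 * k) :: real)"
    by (simp add: powr_realpow[symmetric])
  have "furedi_hajnal_limit k \<pi> \<le> 2 ^ (56 * k)"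
    unfolding furedi_hajnal_limit_def
  \<comment> \<open>Convergence is what gives \<open>lim\<close> its meaning; a bound that holds for
    every \<open>n \<ge> 1\<close> then passes to the limit.\<close>
  proof (rule LIMSEQ_le_const2[OF convergent_LIMSEQ_iff[THEN iffD1, OF convergent_ex_mass[OF \<pi> \<open>k > 0\<close>]]])
    have "real (ex_mass n k \<pi>) / real n \<le> 2 ^ (56 * k)" if "n \<ge> 1" for n
    proof -
      have "ex_mass n k \<pi> \<le> 2 ^ (11 * k) * n" using ex_mass_le[OF \<pi> \<open>k > 0\<close>] that by simp
      also have "\<dots> \<le> 2 ^ (56 * k) * n" by (intro mult_le_mono1 power_increasing) auto
      finally have "real (ex_mass n k \<pi>) \<le> real (2 ^ (56 * k) * n)" by (simp only: of_nat_le_iff)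
      then show ?thesis using that by (simp add: divide_le_eq)
    qed
    then show "\<exists>N. \<forall>n\<ge>N. real (ex_mass n k \<pi>) / real n \<le> 2 ^ (56 * k)" by blast
  qed
  then show "furedi_hajnal_limit k \<pi> \<le> 2 powr (56 * real k)" unfolding powr .
  have "stanley_wilf_limit k \<pi> \<le> 2 ^ (56 * k)"
    unfolding stanley_wilf_limit_def
  proof (rule LIMSEQ_le_const2[OF convergent_LIMSEQ_iff[THEN iffD1, OF convergent_avoiders_count[OF \<pi> \<open>k > 0\<close>]]])
    have "root n (real (avoiders_count n k \<pi>)) \<le> 2 ^ (56 * k)" if "n \<ge> 1" for n
    proof -
      have "real (avoiders_count n k \<pi>) \<le> real (2 ^ (56 * k * n))"
        using avoiders_count_le[OF \<pi> \<open>k > 0\<close>, of n] that by (simp only: of_nat_le_iff)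
      also have "\<dots> = (2 ^ (56 * k)) ^ n" by (simp add: power_mult)
      finally have "root n (real (avoiders_count n k \<pi>)) \<le> root n ((2 ^ (56 * k)) ^ n)"
        using that by (intro real_root_le_mono) auto
      also have "\<dots> = 2 ^ (56 * k)" using that by (intro real_root_power_cancel) auto
      finally show ?thesis .
    qed
    then show "\<exists>N. \<forall>n\<ge>N. root n (real (avoiders_count n k \<pi>)) \<le> 2 ^ (56 * k)" by blast
  qed
  then show "stanley_wilf_limit k \<pi> \<le> 2 powr (56 * real k)" unfolding powr .
qed simp

end
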